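(* Let $W$ be a $1|2$-dimensional $\mathbb{Z}_2$-graded vector space over $\mathfrak K$, let $m\ge0$ be an integer, and let $d_*=\psi^{0,0,m+2}_1$ and $d_{\#}=\psi^{0,1,m+1}_3+\psi^{0,0,m+2}_1-\psi^{1,1,m}_1(m+2)$ in $L_{m+2}$. Then $d_*$ and $d_{\#}$ have no nontrivial extensions: every extension of $d_*$ is equivalent to $d_*$, and every extension of $d_{\#}$ is equivalent to $d_{\#}$.
   Context: $\mathfrak K$ is an algebraically closed field of characteristic zero. $W=\langle w_1,w_2,w_3\rangle$ is the $\mathbb{Z}_2$-graded vector space with $w_1,w_2$ odd and $w_3$ even. $S(W)=\bigoplus_{n\ge1}S^n(W)$ is the reduced $\mathbb{Z}_2$-graded symmetric algebra (with $uv=(-1)^{uv}vu$), with its coalgebra structure $\Delta(v_1\cdots v_n)=\sum_{k=1}^{n-1}\sum_{\sigma\in \mathrm{Sh}(k,n-k)}\epsilon(\sigma)\,v_{\sigma(1)}\cdots v_{\sigma(k)}\otimes v_{\sigma(k+1)}\cdots v_{\sigma(n)}$, where $\mathrm{Sh}(k,n-k)$ is the set of unshuffles and $\epsilon(\sigma)$ is the sign with $v_{\sigma(1)}\cdots v_{\sigma(n)}=\epsilon(\sigma)v_1\cdots v_n$. Put $L_n=\mathrm{Hom}(S^n(W),W)$ and $L=\mathrm{Hom}(S(W),W)=\prod_{n\ge1} L_n$. Each $\varphi\in L_k$ extends to a coderivation $\tilde\varphi$ of $S(W)$ by $\tilde\varphi(v_1\cdots v_n)=\sum_{\sigma\in\mathrm{Sh}(k,n-k)}\epsilon(\sigma)\varphi(v_{\sigma(1)}\cdots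 v_{\sigma(k)})v_{\sigma(k+1)}\cdots v_{\sigma(n)}$, and this identifies $L$ with the coderivations of $S(W)$. The bracket on $L$ is $[\alpha,\beta]=\alpha\tilde\beta-(-1)^{\alpha\beta}\beta\tilde\alpha$. A codifferential (an $L_\infty$ structure on $W$, in the parity-reversed convention) is an odd element $d\in L$ with $[d,d]=0$, equivalently $\tilde d^2=0$. Two codifferentials $d,d'$ are equivalent if there is a parity-preserving coalgebra automorphism $\tilde g$ of $S(W)$ (determined by $g=g_1+g_2+\cdots\in L$, $g_i:S^i(W)\to W$ even, $g_1$ invertible) with $d'=\tilde g^{-1}\circ d\circ\tilde g$. An extension of a codifferential $d_N\in L_N$ is a codifferential $d=d_N+d_{N+1}+\cdots$ with $d_i\in L_i$, whose lowest-degree term is $d_N$ (so $d_N$ is itself an extension of $d_N$). For $I=(i_1,i_2,i_3)$ with $i_1,i_2\in\{0,1\}$, $i_3\ge0$ and $|I|=i_1+i_2+i_3\ge1$, let $w_I=w_1^{i_1}w_2^{i_2}w_3^{i_3}$ and $I!=i_1!i_2!i_3!$. The element $\varphi^I_j\in L_{|I|}$ is defined by $\varphi^I_j(w_J)=I!\,\delta^I_J\,w_j$. It is written $\psi^I_j$ when it is odd. *)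

theory Defs
  imports
    "HOL-Computational_Algebra.Polynomial"
    "HOL-Combinatorics.Permutations"
    "HOL-Library.Poly_Mapping"
begin

section \<open>Free vector spaces\<close>

text \<open>
  All vector spaces below come with a basis \<open>'a\<close> and are modelled as the finitely
  supported functions \<open>'a \<Rightarrow>\<^sub>0 'k\<close>; the basis vector of \<open>a\<close> is \<open>basis a\<close>.
\<close>

definition scale :: "'k::field \<Rightarrow> ('a \<Rightarrow>\<^sub>0 'k) \<Rightarrow> ('a \<Rightarrow>\<^sub>0 'k)" where
  "scale c x = Poly_Mapping.map ((*) c) x"

lemma lookup_scale [simp]: "Poly_Mapping.lookup (scale c x) a = c * Poly_Mapping.lookup x a"
  by (simp add: scale_def Poly_Mapping.map.rep_eq when_def)

lemma vector_space_scale: "vector_space (scale :: 'k::field \<Rightarrow> ('a \<Rightarrow>\<^sub>0 'k) \<Rightarrow> _)"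
  by unfold_locales (auto intro!: poly_mapping_eqI simp: lookup_add algebra_simps)

abbreviation basis :: "'a \<Rightarrow> ('a \<Rightarrow>\<^sub>0 'k::field)" where
  "basis a \<equiv> Poly_Mapping.single a 1"

abbreviation is_linear :: "(('a \<Rightarrow>\<^sub>0 'k::field) \<Rightarrow> ('b \<Rightarrow>\<^sub>0 'k)) \<Rightarrow> bool" where
  "is_linear f \<equiv> Vector_Spaces.linear scale scale f"

text \<open>The linear map with prescribed values on basis vectors.\<close>

definition lin_ext :: "('a \<Rightarrow> ('b \<Rightarrow>\<^sub>0 'k::field)) \<Rightarrow> ('a \<Rightarrow>\<^sub>0 'k) \<Rightarrow> ('b \<Rightarrow>\<^sub>0 'k)" where
  "lin_ext f x = (\<Sum>a\<in>Poly_Mapping.keys x. scale (Poly_Mapping.lookup x a) (f a))"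

lemma lin_ext_basis [simp]: "lin_ext f (basis a) = f a"
  by (rule poly_mapping_eqI) (simp add: lin_ext_def)

lemma lookup_lin_ext:
  assumes "finite A" "Poly_Mapping.keys x \<subseteq> A"
  shows "Poly_Mapping.lookup (lin_ext f x) b =
    (\<Sum>a\<in>A. Poly_Mapping.lookup x a * Poly_Mapping.lookup (f a) b)"
  unfolding lin_ext_def lookup_sum lookup_scale
  by (rule sum.mono_neutral_left) (use assms in \<open>auto simp: in_keys_iff\<close>)

lemma linear_lin_ext: "is_linear (lin_ext f)"
proof -
  have "lin_ext f (x + y) = lin_ext f x + lin_ext f y" for x y
  proof (rule poly_mapping_eqI)
    fix b
    have *: "finite (Poly_Mapping.keys x \<union> Poly_Mapping.keys y)"
      "Poly_Mapping.keys (x + y) \<subseteq> Poly_Mapping.keys x \<union> Poly_Mapping.keys y"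
      by (auto simp: Poly_Mapping.keys_add)
    show "Poly_Mapping.lookup (lin_ext f (x + y)) b =
        Poly_Mapping.lookup (lin_ext f x + lin_ext f y) b"
      by (simp add: lookup_lin_ext[OF *] lookup_lin_ext[OF *(1)] lookup_add
          sum.distrib algebra_simps)
  qed
  moreover have "lin_ext f (scale c x) = scale c (lin_ext f x)" for c x
  proof (rule poly_mapping_eqI)
    fix b
    have "Poly_Mapping.keys (scale c x) \<subseteq> Poly_Mapping.keys x"
      by (auto simp: in_keys_iff)
    then show "Poly_Mapping.lookup (lin_ext f (scale c x)) b =
        Poly_Mapping.lookup (scale c (lin_ext f x)) b"
      by (simp add: lookup_lin_ext[OF finite_keys[of x]]
          sum_distrib_left mult.assoc)
  qed
  ultimately show ?thesis
    by (simp add: Vector_Spaces.linear_iff vector_space_scale)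
qed

definition tensor :: "('a \<Rightarrow>\<^sub>0 'k::field) \<Rightarrow> ('b \<Rightarrow>\<^sub>0 'k) \<Rightarrow> ('a \<times> 'b \<Rightarrow>\<^sub>0 'k)" where
  "tensor x y = lin_ext (\<lambda>a. lin_ext (\<lambda>b. basis (a, b)) y) x"

text \<open>Tensor product of linear maps; it is only used for even maps, so no sign arises.\<close>

definition tensor_map ::
  "(('a \<Rightarrow>\<^sub>0 'k::field) \<Rightarrow> ('c \<Rightarrow>\<^sub>0 'k)) \<Rightarrow> (('b \<Rightarrow>\<^sub>0 'k) \<Rightarrow> ('d \<Rightarrow>\<^sub>0 'k)) \<Rightarrow>
    ('a \<times> 'b \<Rightarrow>\<^sub>0 'k) \<Rightarrow> ('c \<times> 'd \<Rightarrow>\<^sub>0 'k)" where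
  "tensor_map f g = lin_ext (\<lambda>(a, b). tensor (f (basis a)) (g (basis b)))"

text \<open>\<open>pa\<close> and \<open>pb\<close> tell which basis vectors are odd.\<close>

definition even_map ::
  "('a \<Rightarrow> bool) \<Rightarrow> ('b \<Rightarrow> bool) \<Rightarrow> (('a \<Rightarrow>\<^sub>0 'k::field) \<Rightarrow> ('b \<Rightarrow>\<^sub>0 'k)) \<Rightarrow> bool" where
  "even_map pa pb f \<longleftrightarrow> (\<forall>a. \<forall>b\<in>Poly_Mapping.keys (f (basis a)). pb b = pa a)"

definition odd_map ::
  "('a \<Rightarrow> bool) \<Rightarrow> ('b \<Rightarrow> bool) \<Rightarrow> (('a \<Rightarrow>\<^sub>0 'k::field) \<Rightarrow> ('b \<Rightarrow>\<^sub>0 'k)) \<Rightarrow> bool" where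
  "odd_map pa pb f \<longleftrightarrow> (\<forall>a. \<forall>b\<in>Poly_Mapping.keys (f (basis a)). pb b \<noteq> pa a)"


section \<open>The space \<open>W\<close> and its reduced graded symmetric algebra\<close>

datatype letter = W1 | W2 | W3

type_synonym 'k W = "letter \<Rightarrow>\<^sub>0 'k"

definition odd_letter :: "letter \<Rightarrow> bool" where
  "odd_letter v \<longleftrightarrow> v \<noteq> W3"

text \<open>The exponents \<open>I = (i\<^sub>1, i\<^sub>2, i\<^sub>3)\<close> of the basis monomials \<open>w\<^sub>I\<close>.\<close>

typedef mono = "{(i1, i2, i3). i1 \<le> 1 \<and> i2 \<le> 1 \<and> i1 + i2 + i3 \<ge> 1} :: (nat \<times> nat \<times> nat) set"
  by (rule exI[of _ "(0, 0, 1)"]) simp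

text \<open>\<open>Mono i1 i2 i3\<close> is meaningful only if \<open>i1, i2 \<le> 1\<close> and \<open>i1 + i2 + i3 \<ge> 1\<close>.\<close>

definition Mono :: "nat \<Rightarrow> nat \<Rightarrow> nat \<Rightarrow> mono" where
  "Mono i1 i2 i3 = Abs_mono (i1, i2, i3)"

definition deg :: "mono \<Rightarrow> nat" where
  "deg I = (case Rep_mono I of (i1, i2, i3) \<Rightarrow> i1 + i2 + i3)"

definition odd_mono :: "mono \<Rightarrow> bool" where
  "odd_mono I \<longleftrightarrow> (case Rep_mono I of (i1, i2, i3) \<Rightarrow> odd (i1 + i2))"

definition letters :: "mono \<Rightarrow> letter list" where
  "letters I = (case Rep_mono I of (i1, i2, i3) \<Rightarrow>
     replicate i1 W1 @ replicate i2 W2 @ replicate i3 W3)"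

type_synonym 'k S = "mono \<Rightarrow>\<^sub>0 'k"

text \<open>
  Sorting \<open>w\<^sub>I w\<^sub>J\<close> moves \<open>w\<^sub>1\<^bsup>j1\<^esup>\<close> past \<open>w\<^sub>2\<^bsup>i2\<^esup>\<close>; squares of odd elements vanish.
\<close>

definition mult_mono :: "mono \<Rightarrow> mono \<Rightarrow> 'k::field S" where
  "mult_mono I J = (case (Rep_mono I, Rep_mono J) of ((i1, i2, i3), (j1, j2, j3)) \<Rightarrow>
     if i1 + j1 \<le> 1 \<and> i2 + j2 \<le> 1
     then scale ((-1) ^ (i2 * j1)) (basis (Mono (i1 + j1) (i2 + j2) (i3 + j3)))
     else 0)"

definition mult :: "'k::field S \<Rightarrow> 'k S \<Rightarrow> 'k S" where
  "mult x y = lin_ext (\<lambda>I. lin_ext (mult_mono I) y) x"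

fun gen :: "letter \<Rightarrow> mono" where
  "gen W1 = Mono 1 0 0"
| "gen W2 = Mono 0 1 0"
| "gen W3 = Mono 0 0 1"

text \<open>The product \<open>v\<^sub>1 \<cdots> v\<^sub>n\<close>. The algebra has no unit; the empty word is never used.\<close>

fun word :: "letter list \<Rightarrow> 'k::field S" where
  "word [] = 0"
| "word [v] = basis (gen v)"
| "word (v # u # us) = mult (basis (gen v)) (word (u # us))"

text \<open>\<open>u \<mapsto> u v\<^sub>1 \<cdots> v\<^sub>n\<close> for \<open>u \<in> W\<close>, where \<open>v\<^sub>1 \<cdots> v\<^sub>n\<close> may be empty.\<close>

definition mult_word :: "'k::field W \<Rightarrow> letter list \<Rightarrow> 'k S" where
  "mult_word u vs = lin_ext (\<lambda>v. word (v # vs)) u"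


section \<open>Coalgebra structure and coderivations\<close>

text \<open>Permutations are written on the positions \<open>0, \<dots>, k + l - 1\<close>.\<close>

definition Sh :: "nat \<Rightarrow> nat \<Rightarrow> (nat \<Rightarrow> nat) set" where
  "Sh k l = {\<sigma>. \<sigma> permutes {..<k + l} \<and>
     strict_mono_on {..<k} \<sigma> \<and> strict_mono_on {k..<k + l} \<sigma>}"

text \<open>
  The sign \<open>\<epsilon>(\<sigma>)\<close> as the Koszul sign: one factor \<open>-1\<close> for each pair of odd letters whose
  order is reversed. (The relation with the products \<open>v\<^sub>1 \<cdots> v\<^sub>n\<close> does not determine the
  sign when an odd letter is repeated.)
\<close>

definition koszul :: "(nat \<Rightarrow> nat) \<Rightarrow> letter list \<Rightarrow> 'k::field" where
  "koszul \<sigma> vs = (\<Prod>(i, j)\<in>{(i, j). i < j \<and> j < length vs \<and> \<sigma> i > \<sigma> j}.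
     if odd_letter (vs ! \<sigma> i) \<and> odd_letter (vs ! \<sigma> j) then -1 else 1)"

definition subword :: "(nat \<Rightarrow> nat) \<Rightarrow> letter list \<Rightarrow> nat \<Rightarrow> nat \<Rightarrow> letter list" where
  "subword \<sigma> vs a b = map (\<lambda>i. vs ! \<sigma> i) [a..<b]"

definition comult :: "'k::field S \<Rightarrow> (mono \<times> mono \<Rightarrow>\<^sub>0 'k)" where
  "comult = lin_ext (\<lambda>I. let vs = letters I; n = length vs in
     \<Sum>k\<in>{1..n - 1}. \<Sum>\<sigma>\<in>Sh k (n - k).
       scale (koszul \<sigma> vs) (tensor (word (subword \<sigma> vs 0 k)) (word (subword \<sigma> vs k n))))"

text \<open>
  An element of \<open>L = Hom(S(W), W)\<close> is a linear map \<open>'k S \<Rightarrow> 'k W\<close>, and its component in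
  \<open>L\<^sub>n\<close> is its restriction to \<open>S\<^sup>n(W)\<close>, extended by zero.
\<close>

definition component :: "nat \<Rightarrow> ('k::field S \<Rightarrow> 'k W) \<Rightarrow> 'k S \<Rightarrow> 'k W" where
  "component n \<phi> = lin_ext (\<lambda>I. if deg I = n then \<phi> (basis I) else 0)"

text \<open>
  The sum over \<open>k\<close> of the extensions of the components of \<open>\<phi>\<close> in \<open>L\<^sub>k\<close>; only the
  component in \<open>L\<^sub>k\<close> contributes to the summand for \<open>k\<close>.
\<close>

definition coder :: "('k::field S \<Rightarrow> 'k W) \<Rightarrow> 'k S \<Rightarrow> 'k S" where
  "coder \<phi> = lin_ext (\<lambda>I. let vs = letters I; n = length vs in
     \<Sum>k\<in>{1..n}. \<Sum>\<sigma>\<in>Sh k (n - k).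
       scale (koszul \<sigma> vs) (mult_word (\<phi> (word (subword \<sigma> vs 0 k))) (subword \<sigma> vs k n)))"

abbreviation odd_L :: "('k::field S \<Rightarrow> 'k W) \<Rightarrow> bool" where
  "odd_L \<equiv> odd_map odd_mono odd_letter"

text \<open>The bracket of homogeneous (even or odd) elements of \<open>L\<close>.\<close>

definition bracket ::
  "('k::field S \<Rightarrow> 'k W) \<Rightarrow> ('k S \<Rightarrow> 'k W) \<Rightarrow> 'k S \<Rightarrow> 'k W" where
  "bracket \<alpha> \<beta> = (\<lambda>x. \<alpha> (coder \<beta> x) -
     scale (if odd_L \<alpha> \<and> odd_L \<beta> then -1 else 1) (\<beta> (coder \<alpha> x)))"

definition codifferential :: "('k::field S \<Rightarrow> 'k W) \<Rightarrow> bool" where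
  "codifferential d \<longleftrightarrow> is_linear d \<and> odd_L d \<and> bracket d d = (\<lambda>x. 0)"

definition coalgebra_automorphism :: "('k::field S \<Rightarrow> 'k S) \<Rightarrow> bool" where
  "coalgebra_automorphism G \<longleftrightarrow> is_linear G \<and> bij G \<and>
     (\<forall>x. comult (G x) = tensor_map G G (comult x))"

definition equivalent :: "('k::field S \<Rightarrow> 'k W) \<Rightarrow> ('k S \<Rightarrow> 'k W) \<Rightarrow> bool" where
  "equivalent d d' \<longleftrightarrow> (\<exists>G. coalgebra_automorphism G \<and> even_map odd_mono odd_mono G \<and>
     coder d' = inv G \<circ> coder d \<circ> G)"

text \<open>\<open>d\<close> is an extension of the codifferential \<open>dN\<close> in \<open>L\<^sub>N\<close>.\<close>

definition is_extension ::
  "nat \<Rightarrow> ('k::field S \<Rightarrow> 'k W) \<Rightarrow> ('k S \<Rightarrow> 'k W) \<Rightarrow> bool" where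
  "is_extension N dN d \<longleftrightarrow> codifferential dN \<and> codifferential d \<and>
     (\<forall>n<N. component n d = (\<lambda>x. 0)) \<and> component N d = dN"


section \<open>The codifferentials\<close>

text \<open>\<open>\<phi>\<^sup>I\<^sub>j\<close> for \<open>I = (i1, i2, i3)\<close>, written \<open>\<psi>\<^sup>I\<^sub>j\<close> when it is odd.\<close>

definition phi :: "nat \<Rightarrow> nat \<Rightarrow> nat \<Rightarrow> letter \<Rightarrow> 'k::field_char_0 S \<Rightarrow> 'k W" where
  "phi i1 i2 i3 j x =
     scale (fact i1 * fact i2 * fact i3 * Poly_Mapping.lookup x (Mono i1 i2 i3)) (basis j)"

definition d_star :: "nat \<Rightarrow> 'k::field_char_0 S \<Rightarrow> 'k W" where
  "d_star m = phi 0 0 (m + 2) W1"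

definition d_sharp :: "nat \<Rightarrow> 'k::field_char_0 S \<Rightarrow> 'k W" where
  "d_sharp m = (\<lambda>x. phi 0 1 (m + 1) W3 x + phi 0 0 (m + 2) W1 x
     - scale (of_nat (m + 2)) (phi 1 1 m W1 x))"

end

theory Submission
  imports Defs "HOL-Computational_Algebra.Formal_Power_Series"
begin

text \<open>
  Dually, \<open>S(W)\<close> is the algebra of functions on formal \<open>1|2\<close>-space with even coordinate \<open>x\<close> and
  odd coordinates \<open>\<theta>\<^sub>1, \<theta>\<^sub>2\<close>, a codifferential is an odd vector field
  \<open>Q = (a + a'\<theta>\<^sub>1\<theta>\<^sub>2)\<partial>\<^sub>1 + (b + b'\<theta>\<^sub>1\<theta>\<^sub>2)\<partial>\<^sub>2 + (c\<^sub>1\<theta>\<^sub>1 + c\<^sub>2\<theta>\<^sub>2)\<partial>\<^sub>x\<close> with \<open>Q\<^sup>2 = 0\<close>, and equivalence is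
  a change of coordinates. For an extension of either codifferential, with \<open>N = m + 2\<close>, we have
  \<open>a = x\<^sup>N\<alpha>\<close> with \<open>\<alpha>(0) = 1\<close> and \<open>b = x\<^sup>N\<beta>\<close>. Since \<open>a \<noteq> 0\<close>, the equation \<open>Q\<^sup>2 = 0\<close> expresses
  \<open>a', b', c\<^sub>1\<close> through \<open>a, b, c\<^sub>2\<close>, so only these three have to be normalised. The substitution
  \<open>\<theta>\<^sub>1 \<mapsto> \<alpha>\<theta>\<^sub>1, \<theta>\<^sub>2 \<mapsto> \<beta>\<theta>\<^sub>1 + \<gamma>\<theta>\<^sub>2, x \<mapsto> x + f\<theta>\<^sub>1\<theta>\<^sub>2\<close> takes care of \<open>\<alpha>\<close> and \<open>\<beta>\<close>. In the case of
  \<open>d\<^sub>*\<close>, the series \<open>c\<^sub>2\<close> is divisible by \<open>x\<^sup>N\<close> and is removed by \<open>f = c\<^sub>2 / x\<^sup>N\<close>; in the case of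
  \<open>d\<^sub>#\<close>, it is \<open>x\<^sup>N\<^sup>-\<^sup>1\<close> times a unit, which \<open>\<gamma>\<close> absorbs.
\<close>

section \<open>Unshuffles as subsets of positions, and their Koszul signs\<close>

section \<open>Unshuffles and subsets\<close>

lemma nths_eq_map_filter: "nths xs A = map ((!) xs) (filter (\<lambda>i. i \<in> A) [0..<length xs])"
proof -
  have "zip xs [0..<length xs] = map (\<lambda>i. (xs ! i, i)) [0..<length xs]"
    by (rule nth_equalityI) auto
  then show ?thesis
    by (simp add: nths_def filter_map o_def)
qed

lemma nths_replicate:
  assumes "A \<subseteq> {..<n}"
  shows "nths (replicate n x) A = replicate (card A) x"
proof -
  have "set (nths (replicate n x) A) \<subseteq> {x}"
    by (rule order_trans[OF set_nths_subset]) auto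
  moreover have "{i. i < n \<and> i \<in> A} = A" using assms by auto
  then have "length (nths (replicate n x) A) = card A"
    by (simp add: length_nths)
  ultimately show ?thesis
    by (metis in_mono replicate_eqI singletonD)
qed

text \<open>Both blocks of an unshuffle are increasing, so each is the sorted list of its set of
  values, and the second set is the complement of the first.\<close>

lemma map_filter_Sh:
  assumes "\<sigma> \<in> Sh k l"
  shows "map \<sigma> [0..<k] = filter (\<lambda>i. i \<in> \<sigma> ` {..<k}) [0..<k + l]"
    and "map \<sigma> [k..<k + l] = filter (\<lambda>i. i \<notin> \<sigma> ` {..<k}) [0..<k + l]"
proof -
  from assms have p: "\<sigma> permutes {..<k + l}" and m1: "strict_mono_on {..<k} \<sigma>"
    and m2: "strict_mono_on {k..<k + l} \<sigma>" by (auto simp: Sh_def)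
  have inj: "inj \<sigma>" using p by (rule permutes_inj)
  have im: "\<sigma> ` {..<k + l} = {..<k + l}" using p by (rule permutes_image)
  have U: "{..<k + l} = {..<k} \<union> {k..<k + l}" by auto
  have c: "\<sigma> ` {k..<k + l} = {..<k + l} - \<sigma> ` {..<k}"
  proof -
    have "\<sigma> ` {k..<k + l} = \<sigma> ` ({..<k + l} - {..<k})" by (rule arg_cong[of _ _ "image \<sigma>"]) auto
    also have "\<dots> = {..<k + l} - \<sigma> ` {..<k}" unfolding image_set_diff[OF inj] im ..
    finally show ?thesis .
  qed
  have sub: "\<sigma> ` {..<k} \<subseteq> {..<k + l}" using im by auto
  have s1: "sorted (map \<sigma> [0..<k])"
    unfolding sorted_iff_nth_mono
    using m1 by (auto simp: strict_mono_on_def le_less)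
  have "\<sigma> a \<le> \<sigma> b" if "k \<le> a" "a \<le> b" "b < k + l" for a b
    using that m2 by (cases "a = b") (auto simp: strict_mono_on_def le_less)
  then have s2: "sorted (map \<sigma> [k..<k + l])"
    by (auto simp: sorted_iff_nth_mono)
  have d: "distinct (map \<sigma> [a..<b])" for a b
    using inj_on_subset[OF inj] by (simp add: distinct_map)
  show "map \<sigma> [0..<k] = filter (\<lambda>i. i \<in> \<sigma> ` {..<k}) [0..<k + l]"
    by (rule sorted_distinct_set_unique) (use s1 d sub in \<open>auto simp: sorted_wrt_filter atLeast0LessThan\<close>)
  show "map \<sigma> [k..<k + l] = filter (\<lambda>i. i \<notin> \<sigma> ` {..<k}) [0..<k + l]"
    by (rule sorted_distinct_set_unique) (use s2 d c in \<open>auto simp: sorted_wrt_filter atLeast0LessThan\<close>)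
qed

text \<open>An unshuffle is recovered from the values on its first block by listing them, and then
  the remaining positions, in increasing order. Sums over unshuffles thus become sums over subsets
  of positions.\<close>

lemma bij_betw_Sh:
  "bij_betw (\<lambda>\<sigma>. \<sigma> ` {..<k}) (Sh k l) {A. A \<subseteq> {..<k + l} \<and> card A = k}"
  unfolding bij_betw_def
proof
  show "inj_on (\<lambda>\<sigma>. \<sigma> ` {..<k}) (Sh k l)"
  proof (rule inj_onI)
    fix \<sigma> \<tau> assume s: "\<sigma> \<in> Sh k l" and t: "\<tau> \<in> Sh k l" and eq: "\<sigma> ` {..<k} = \<tau> ` {..<k}"
    have "map \<sigma> [0..<k] = map \<tau> [0..<k]" "map \<sigma> [k..<k + l] = map \<tau> [k..<k + l]"
      using map_filter_Sh[OF s] map_filter_Sh[OF t] eq by simp_all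
    then have "\<sigma> i = \<tau> i" if "i < k + l" for i
      using that by (cases "i < k") (simp_all add: map_eq_conv)
    moreover have "\<sigma> i = i" "\<tau> i = i" if "\<not> i < k + l" for i
      using s t that by (auto simp: Sh_def intro: permutes_not_in)
    ultimately show "\<sigma> = \<tau>" by (metis ext)
  qed
  show "(\<lambda>\<sigma>. \<sigma> ` {..<k}) ` Sh k l = {A. A \<subseteq> {..<k + l} \<and> card A = k}"
  proof (intro equalityI subsetI)
    fix A assume "A \<in> (\<lambda>\<sigma>. \<sigma> ` {..<k}) ` Sh k l"
    then obtain \<sigma> where s: "\<sigma> permutes {..<k + l}" and A: "A = \<sigma> ` {..<k}"
      by (auto simp: Sh_def)
    have "A \<subseteq> \<sigma> ` {..<k + l}" unfolding A by auto
    then show "A \<in> {A. A \<subseteq> {..<k + l} \<and> card A = k}"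
      using s by (simp add: A permutes_image card_image inj_on_subset[OF permutes_inj[OF s]])
  next
    fix A assume "A \<in> {A. A \<subseteq> {..<k + l} \<and> card A = k}"
    then have A: "A \<subseteq> {..<k + l}" "card A = k" by auto
    define xs where "xs = filter (\<lambda>i. i \<in> A) [0..<k + l]"
    define ys where "ys = filter (\<lambda>i. i \<notin> A) [0..<k + l]"
    define \<sigma> where "\<sigma> i = (if i < k + l then (xs @ ys) ! i else i)" for i
    have sx: "set xs = A" using A by (auto simp: xs_def)
    have sy: "set ys = {..<k + l} - A" by (auto simp: ys_def)
    have dx: "distinct xs" and dy: "distinct ys" by (auto simp: xs_def ys_def)
    have lx: "length xs = k" using distinct_card[OF dx] sx A by simp
    have ly: "length ys = l" using distinct_card[OF dy] sy A
      by (simp add: card_Diff_subset finite_subset[OF A(1)])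
    have stx: "sorted_wrt (<) xs" and sty: "sorted_wrt (<) ys"
      unfolding xs_def ys_def by (simp_all add: sorted_wrt_filter)
    have "bij_betw ((!) (xs @ ys)) {..<k + l} {..<k + l}"
      by (rule bij_betw_nth) (use dx dy sx sy lx ly A in auto)
    then have b: "bij_betw \<sigma> {..<k + l} {..<k + l}"
      by (rule bij_betw_cong[THEN iffD1, rotated]) (simp add: \<sigma>_def)
    have "\<sigma> permutes {..<k + l}"
      by (rule bij_imp_permutes[OF b]) (simp add: \<sigma>_def)
    moreover have "strict_mono_on {..<k} \<sigma>"
    proof (rule strict_mono_onI)
      fix r t assume "r \<in> {..<k}" "t \<in> {..<k}" "r < t"
      then show "\<sigma> r < \<sigma> t"
        using sorted_wrt_nth_less[OF stx, of r t] by (simp add: \<sigma>_def nth_append lx)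
    qed
    moreover have "strict_mono_on {k..<k + l} \<sigma>"
    proof (rule strict_mono_onI)
      fix r t assume "r \<in> {k..<k + l}" "t \<in> {k..<k + l}" "r < t"
      then show "\<sigma> r < \<sigma> t"
        using sorted_wrt_nth_less[OF sty, of "r - k" "t - k"]
        by (simp add: \<sigma>_def nth_append lx ly)
    qed
    ultimately have "\<sigma> \<in> Sh k l" by (simp add: Sh_def)
    moreover have "\<sigma> ` {..<k} = A"
    proof -
      have "\<sigma> ` {..<k} = (!) xs ` {..<k}"
        by (rule image_cong) (auto simp: \<sigma>_def nth_append lx)
      also have "\<dots> = set xs" using lx by (metis lessThan_atLeast0 list.set_map map_nth set_upt)
      finally show ?thesis using sx by simp
    qed
    ultimately show "A \<in> (\<lambda>\<sigma>. \<sigma> ` {..<k}) ` Sh k l" by blast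
  qed
qed

lemma subword_Sh:
  assumes "\<sigma> \<in> Sh k l" "length vs = k + l"
  shows "subword \<sigma> vs 0 k = nths vs (\<sigma> ` {..<k})"
    and "subword \<sigma> vs k (k + l) = nths vs (- \<sigma> ` {..<k})"
proof -
  have "subword \<sigma> vs a b = map ((!) vs) (map \<sigma> [a..<b])" for a b
    by (simp add: subword_def)
  then show "subword \<sigma> vs 0 k = nths vs (\<sigma> ` {..<k})"
    and "subword \<sigma> vs k (k + l) = nths vs (- \<sigma> ` {..<k})"
    unfolding nths_eq_map_filter assms(2) by (simp_all only: map_filter_Sh[OF assms(1)] Compl_iff)
qed

definition sorted_word :: "nat \<Rightarrow> nat \<Rightarrow> nat \<Rightarrow> letter list" where
  "sorted_word i j n = replicate i W1 @ replicate j W2 @ replicate n W3"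

lemma odd_letter_sorted_word:
  "p < i + j + n \<Longrightarrow> odd_letter (sorted_word i j n ! p) \<longleftrightarrow> p < i + j"
  by (auto simp: sorted_word_def nth_append odd_letter_def)

text \<open>Two odd letters of a sorted word can only be \<open>W1\<close> and \<open>W2\<close> at
  positions 0 and 1, so a single pair can contribute a sign: it is reversed exactly when
  \<open>W2\<close> goes to the first block and \<open>W1\<close> to the second.\<close>

lemma koszul_Sh:
  assumes s: "\<sigma> \<in> Sh k l" and len: "i + j + n = k + l" and ij: "i \<le> 1" "j \<le> 1"
  shows "(koszul \<sigma> (sorted_word i j n) :: 'k::field) =
    (if i = 1 \<and> j = 1 \<and> 0 \<notin> \<sigma> ` {..<k} \<and> 1 \<in> \<sigma> ` {..<k} then -1 else 1)"
proof -
  define P where "P = {(p, q). p < q \<and> q < k + l \<and> \<sigma> p > \<sigma> q}"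
  have fin: "finite P"
    by (rule finite_subset[of _ "{..<k+l} \<times> {..<k+l}"]) (auto simp: P_def)
  from s have p: "\<sigma> permutes {..<k + l}" and m1: "strict_mono_on {..<k} \<sigma>"
    and m2: "strict_mono_on {k..<k + l} \<sigma>" by (auto simp: Sh_def)
  have inj: "inj \<sigma>" using p by (rule permutes_inj)
  have lt: "\<sigma> a < k + l" if "a < k + l" for a
    using permutes_in_image[OF p, of a] that by simp
  have "(koszul \<sigma> (sorted_word i j n) :: 'k) =
    (\<Prod>(p, q)\<in>P. if odd_letter (sorted_word i j n ! \<sigma> p) \<and> odd_letter (sorted_word i j n ! \<sigma> q)
      then -1 else 1)"
    unfolding koszul_def P_def len[symmetric] by (simp add: sorted_word_def add.assoc)
  also have "\<dots> = (\<Prod>(p, q)\<in>P. if i = 1 \<and> j = 1 \<and> \<sigma> p = 1 \<and> \<sigma> q = 0 then -1 else 1)"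
  proof (rule prod.cong[OF refl])
    fix x assume x: "x \<in> P"
    obtain a b where [simp]: "x = (a, b)" by (cases x)
    from x have ab: "\<sigma> b < \<sigma> a" "\<sigma> a < i + j + n" "\<sigma> b < i + j + n"
      using lt by (auto simp: P_def len)
    have "(odd_letter (sorted_word i j n ! \<sigma> a) \<and> odd_letter (sorted_word i j n ! \<sigma> b))
       = (i = 1 \<and> j = 1 \<and> \<sigma> a = 1 \<and> \<sigma> b = 0)"
      unfolding odd_letter_sorted_word[OF ab(2)] odd_letter_sorted_word[OF ab(3)]
      using ab ij by auto
    then show "(case x of (p, q) \<Rightarrow> if odd_letter (sorted_word i j n ! \<sigma> p) \<and>
          odd_letter (sorted_word i j n ! \<sigma> q) then -1 else 1)
       = (case x of (p, q) \<Rightarrow> if i = 1 \<and> j = 1 \<and> \<sigma> p = 1 \<and> \<sigma> q = 0 then -1 else (1::'k))"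
      by simp
  qed
  also have "\<dots> = (if i = 1 \<and> j = 1 \<and> 0 \<notin> \<sigma> ` {..<k} \<and> 1 \<in> \<sigma> ` {..<k} then -1 else 1)"
  proof (cases "i = 1 \<and> j = 1 \<and> 0 \<notin> \<sigma> ` {..<k} \<and> 1 \<in> \<sigma> ` {..<k}")
    case True
    then obtain a where a: "a < k" "\<sigma> a = 1" by auto
    have "0 \<in> \<sigma> ` {..<k + l}" using True len permutes_image[OF p] by auto
    then obtain b where b: "b < k + l" "\<sigma> b = 0" by auto
    with True have "\<not> b < k" by (metis image_eqI lessThan_iff)
    with a b have ab: "(a, b) \<in> P" by (auto simp: P_def)
    have "\<sigma> p = 1 \<and> \<sigma> q = 0 \<longleftrightarrow> (p, q) = (a, b)" for p q
      using injD[OF inj, of p a] injD[OF inj, of q b] a b by auto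
    then have "(\<Prod>(p, q)\<in>P. if i = 1 \<and> j = 1 \<and> \<sigma> p = 1 \<and> \<sigma> q = 0 then -1 else (1::'k)) =
      (\<Prod>x\<in>P. if x = (a, b) then -1 else 1)"
      using True by (simp add: split_beta prod_eq_iff)
    also have "\<dots> = -1" using fin ab by simp
    finally show ?thesis using True by simp
  next
    case False
    \<comment> \<open>Both blocks are increasing, so a reversed pair has its first entry in the
      first block and its second entry in the second block.\<close>
    have nP: False if P: "(a, b) \<in> P" and *: "i = 1 \<and> j = 1 \<and> \<sigma> a = 1 \<and> \<sigma> b = 0" for a b
    proof -
      from P have ab: "a < b" "b < k + l" "\<sigma> b < \<sigma> a" by (auto simp: P_def)
      have bk: "\<not> b < k" using strict_mono_onD[OF m1, of a b] ab by auto
      have ak: "a < k" using strict_mono_onD[OF m2, of a b] ab by force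
      have "c = b" if "\<sigma> c = 0" for c using injD[OF inj, of c b] that * by simp
      then have "0 \<notin> \<sigma> ` {..<k}" using bk by force
      moreover have "1 \<in> \<sigma> ` {..<k}" using ak * by force
      ultimately show False using False * by simp
    qed
    then have "(\<Prod>(p, q)\<in>P. if i = 1 \<and> j = 1 \<and> \<sigma> p = 1 \<and> \<sigma> q = 0 then -1 else (1::'k)) = 1"
      by (intro prod.neutral) (auto, blast)
    then show ?thesis using False by auto
  qed
  finally show ?thesis .
qed

definition unshuffle_sign :: "nat \<Rightarrow> nat \<Rightarrow> nat set \<Rightarrow> 'k::field" where
  "unshuffle_sign i j A = (if i = 1 \<and> j = 1 \<and> 0 \<notin> A \<and> 1 \<in> A then -1 else 1)"

definition unshuffle_sum ::
    "(letter list \<Rightarrow> letter list \<Rightarrow> 'k::field) \<Rightarrow> nat \<Rightarrow> nat \<Rightarrow> nat \<Rightarrow> 'k" where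
  "unshuffle_sum H i j n = (\<Sum>A\<in>Pow {..<i + j + n}. unshuffle_sign i j A *
     H (nths (sorted_word i j n) A) (nths (sorted_word i j n) (- A)))"

lemma length_sorted_word [simp]: "length (sorted_word i j n) = i + j + n"
  by (simp add: sorted_word_def)

lemma sum_Sh:
  assumes "i \<le> 1" "j \<le> 1" "k \<le> i + j + n"
  defines "vs \<equiv> sorted_word i j n"
  shows "(\<Sum>\<sigma>\<in>Sh k (i + j + n - k). koszul \<sigma> vs * H (subword \<sigma> vs 0 k) (subword \<sigma> vs k (i + j + n)))
    = (\<Sum>A | A \<subseteq> {..<i + j + n} \<and> card A = k. unshuffle_sign i j A * H (nths vs A) (nths vs (- A)))"
proof -
  define l where "l = i + j + n - k"
  have N: "i + j + n = k + l" using assms by (simp add: l_def)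
  have "(\<Sum>\<sigma>\<in>Sh k l. koszul \<sigma> vs * H (subword \<sigma> vs 0 k) (subword \<sigma> vs k (k + l))) =
    (\<Sum>\<sigma>\<in>Sh k l. unshuffle_sign i j (\<sigma> ` {..<k}) * H (nths vs (\<sigma> ` {..<k})) (nths vs (- \<sigma> ` {..<k})))"
  proof (rule sum.cong[OF refl])
    fix \<sigma> assume s: "\<sigma> \<in> Sh k l"
    show "koszul \<sigma> vs * H (subword \<sigma> vs 0 k) (subword \<sigma> vs k (k + l)) =
      unshuffle_sign i j (\<sigma> ` {..<k}) * H (nths vs (\<sigma> ` {..<k})) (nths vs (- \<sigma> ` {..<k}))"
      unfolding vs_def unshuffle_sign_def koszul_Sh[OF s N assms(1,2)]
      by (simp only: subword_Sh[OF s] N length_sorted_word)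
  qed
  also have "\<dots> = (\<Sum>A | A \<subseteq> {..<k + l} \<and> card A = k. unshuffle_sign i j A * H (nths vs A) (nths vs (- A)))"
    by (rule sum.reindex_bij_betw[OF bij_betw_Sh])
  finally show ?thesis by (simp add: N)
qed

text \<open>This serves both \<open>coder\<close>, where only the size 0 is missing from
  \<open>K\<close>, and \<open>comult\<close>, where the full size is missing as well. At a missing
  size one block is the empty word, where \<open>H\<close> is assumed to vanish, so the sum extends
  to all subsets.\<close>

lemma sum_sum_Sh:
  assumes "i \<le> 1" "j \<le> 1"
    and K: "K \<subseteq> {..i + j + n}"
    and 0: "0 \<notin> K \<Longrightarrow> (\<And>us. H [] us = 0)"
    and N: "i + j + n \<notin> K \<Longrightarrow> (\<And>us. H us [] = 0)"
    and K': "{1..<i + j + n} \<subseteq> K"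
  defines "vs \<equiv> sorted_word i j n"
  shows "(\<Sum>k\<in>K. \<Sum>\<sigma>\<in>Sh k (i + j + n - k). koszul \<sigma> vs *
      H (subword \<sigma> vs 0 k) (subword \<sigma> vs k (i + j + n))) = unshuffle_sum H i j n"
proof -
  let ?N = "i + j + n"
  let ?t = "\<lambda>A. unshuffle_sign i j A * H (nths vs A) (nths vs (- A))"
  have "(\<Sum>k\<in>K. \<Sum>\<sigma>\<in>Sh k (?N - k). koszul \<sigma> vs * H (subword \<sigma> vs 0 k) (subword \<sigma> vs k ?N)) =
    (\<Sum>k\<in>K. \<Sum>A | A \<subseteq> {..<?N} \<and> card A = k. ?t A)"
    unfolding vs_def by (rule sum.cong[OF refl]) (rule sum_Sh, use assms in auto)
  also have "\<dots> = (\<Sum>k\<le>?N. \<Sum>A | A \<subseteq> {..<?N} \<and> card A = k. ?t A)"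
  proof (rule sum.mono_neutral_left)
    show "\<forall>k\<in>{..?N} - K. (\<Sum>A | A \<subseteq> {..<?N} \<and> card A = k. ?t A) = 0"
    proof (intro ballI sum.neutral)
      fix k A assume k: "k \<in> {..?N} - K" and A: "A \<in> {A. A \<subseteq> {..<?N} \<and> card A = k}"
      have "finite A" using A finite_subset by auto
      from k K' have "k \<notin> {1..<?N}" "k \<le> ?N" by auto
      then consider "k = 0" | "k = ?N" by force
      then show "?t A = 0"
      proof cases
        case 1
        then have "A = {}" using A \<open>finite A\<close> by auto
        then show ?thesis using 0 1 k by simp
      next
        case 2
        then have "A = {..<?N}" using A by (metis (mono_tags) card_lessThan card_subset_eq finite_lessThan mem_Collect_eq)
        then have "nths vs (- A) = []" by (simp add: vs_def nths_eq_map_filter filter_empty_conv)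
        then show ?thesis using N 2 k by simp
      qed
    qed
  qed (use K in auto)
  also have "\<dots> = (\<Sum>k\<le>?N. \<Sum>A | A \<in> Pow {..<?N} \<and> card A = k. ?t A)" by simp
  also have "\<dots> = (\<Sum>A\<in>Pow {..<?N}. ?t A)"
    by (rule sum.group) (auto simp: subset_eq_atLeast0_lessThan_card lessThan_atLeast0)
  finally show ?thesis by (simp add: unshuffle_sum_def vs_def)
qed

section \<open>Sums over unshuffles of a sorted word as Cauchy products\<close>

lemma sum_Pow_Suc:
  "(\<Sum>A\<in>Pow {..<Suc n}. f A) = (\<Sum>A\<in>Pow {..<n}. f (Suc ` A) + f (insert 0 (Suc ` A)))"
proof -
  have "(\<Sum>A\<in>Pow {..<Suc n}. f A) =
     (\<Sum>A\<in>Pow (Suc ` {..<n}). f A) + (\<Sum>A\<in>insert 0 ` Pow (Suc ` {..<n}). f A)"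
    unfolding lessThan_Suc_eq_insert_0 Pow_insert by (rule sum.union_disjoint) auto
  also have "(\<Sum>A\<in>insert 0 ` Pow (Suc ` {..<n}). f A) = (\<Sum>A\<in>Pow (Suc ` {..<n}). f (insert 0 A))"
    by (subst sum.reindex) (auto simp: inj_on_def o_def)
  also have "Pow (Suc ` {..<n}) = image Suc ` Pow {..<n}" by (rule image_Pow_surj[symmetric]) simp
  finally show ?thesis
    by (simp add: sum.reindex inj_on_image_Pow sum.distrib)
qed

text \<open>Grouping subsets by size gives binomial coefficients; division by \<open>fact n\<close>
  turns them into the weights of a Cauchy product of exponential generating functions.\<close>

lemma sum_Pow_card:
  fixes f :: "nat \<Rightarrow> 'k::field_char_0"
  assumes "\<And>A. A \<subseteq> {..<n} \<Longrightarrow> g A = f (card A)"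
  shows "(\<Sum>A\<in>Pow {..<n}. g A) / fact n = (\<Sum>a = 0..n. f a / (fact a * fact (n - a)))"
proof -
  have "(\<Sum>A\<in>Pow {..<n}. g A) = (\<Sum>a = 0..n. \<Sum>A | A \<in> Pow {..<n} \<and> card A = a. g A)"
    by (rule sum.group[symmetric]) (auto simp: subset_eq_atLeast0_lessThan_card lessThan_atLeast0)
  also have "\<dots> = (\<Sum>a = 0..n. of_nat (n choose a) * f a)"
  proof (rule sum.cong[OF refl])
    fix a
    have "(\<Sum>A | A \<in> Pow {..<n} \<and> card A = a. g A) = (\<Sum>A | A \<subseteq> {..<n} \<and> card A = a. f a)"
      by (rule sum.cong) (auto simp: assms)
    also have "\<dots> = of_nat (n choose a) * f a"
      using n_subsets[of "{..<n}" a] by simp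
    finally show "(\<Sum>A | A \<in> Pow {..<n} \<and> card A = a. g A) = of_nat (n choose a) * f a" .
  qed
  also have "\<dots> = fact n * (\<Sum>a = 0..n. f a / (fact a * fact (n - a)))"
    unfolding sum_distrib_left by (rule sum.cong) (auto simp: binomial_fact)
  finally show ?thesis by simp
qed

lemma nths_replicate_Compl:
  assumes "A \<subseteq> {..<n}"
  shows "nths (replicate n x) (- A) = replicate (n - card A) x"
proof -
  have "nths (replicate n x) (- A) = nths (replicate n x) ({..<n} - A)"
    unfolding nths_eq_map_filter by (intro arg_cong[where f = "map _"] filter_cong) auto
  then show ?thesis using assms
    by (simp add: nths_replicate card_Diff_subset finite_subset)
qed

lemma Suc_vimage_simps:
  "{j. Suc j \<in> Suc ` A} = A" "{j. Suc j \<in> insert 0 (Suc ` A)} = A"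
  "{j. Suc j \<notin> Suc ` A} = - A" "{j. Suc j \<in> - Suc ` A} = - A" "{j. Suc j \<in> - insert 0 (Suc ` A)} = - A"
  by auto

lemmas nths_Cons_Suc = nths_Cons[of _ _ "Suc ` A" for A] nths_Cons[of _ _ "insert 0 (Suc ` A)" for A]
  nths_Cons[of _ _ "- Suc ` A" for A] nths_Cons[of _ _ "- insert 0 (Suc ` A)" for A]

lemma sorted_word_simps:
  "sorted_word (Suc 0) j n = W1 # sorted_word 0 j n"
  "sorted_word 0 (Suc 0) n = W2 # sorted_word 0 0 n"
  by (simp_all add: sorted_word_def)

lemma nths_sorted_word:
  "A \<subseteq> {..<n} \<Longrightarrow> nths (sorted_word 0 0 n) A = sorted_word 0 0 (card A)"
  "A \<subseteq> {..<n} \<Longrightarrow> nths (sorted_word 0 0 n) (- A) = sorted_word 0 0 (n - card A)"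
  by (simp_all add: sorted_word_def nths_replicate nths_replicate_Compl)

lemmas unshuffle_sum_simps = unshuffle_sum_def unshuffle_sign_def sum_Pow_Suc
  sorted_word_simps nths_Cons_Suc Suc_vimage_simps nths_sorted_word

text \<open>In this and the next three lemmas the odd letters, if any, are split off one at a time
  by \<open>sum_Pow_Suc\<close>. The even letters are interchangeable, so only their number in each
  block counts.\<close>

lemma unshuffle_sum_00:
  "unshuffle_sum H 0 0 n / fact n =
   (\<Sum>a = 0..n. H (sorted_word 0 0 a) (sorted_word 0 0 (n - a)) /
      (fact a * fact (n - a)) :: 'k::field_char_0)"
  unfolding unshuffle_sum_def add_0 by (rule sum_Pow_card) (simp add: unshuffle_sum_simps)

lemma unshuffle_sum_10:
  "unshuffle_sum H 1 0 n / fact n =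
   (\<Sum>a = 0..n. (H (sorted_word 0 0 a) (sorted_word 1 0 (n - a)) +
      H (sorted_word 1 0 a) (sorted_word 0 0 (n - a))) / (fact a * fact (n - a)) :: 'k::field_char_0)"
  unfolding unshuffle_sum_def One_nat_def plus_nat.add_Suc add_0 add_0_right sum_Pow_Suc
  by (rule sum_Pow_card) (simp add: unshuffle_sum_simps)

lemma unshuffle_sum_01:
  "unshuffle_sum H 0 1 n / fact n =
   (\<Sum>a = 0..n. (H (sorted_word 0 0 a) (sorted_word 0 1 (n - a)) +
      H (sorted_word 0 1 a) (sorted_word 0 0 (n - a))) / (fact a * fact (n - a)) :: 'k::field_char_0)"
  unfolding unshuffle_sum_def One_nat_def plus_nat.add_Suc add_0 add_0_right sum_Pow_Suc
  by (rule sum_Pow_card) (simp add: unshuffle_sum_simps)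

text \<open>The minus sign belongs to the split that sends \<open>W2\<close> to the first block and
  \<open>W1\<close> to the second.\<close>

lemma unshuffle_sum_11:
  "unshuffle_sum H 1 1 n / fact n =
   (\<Sum>a = 0..n. (H (sorted_word 0 0 a) (sorted_word 1 1 (n - a))
       - H (sorted_word 0 1 a) (sorted_word 1 0 (n - a))
       + H (sorted_word 1 0 a) (sorted_word 0 1 (n - a))
       + H (sorted_word 1 1 a) (sorted_word 0 0 (n - a))) /
      (fact a * fact (n - a)) :: 'k::field_char_0)"
  unfolding unshuffle_sum_def One_nat_def plus_nat.add_Suc add_0 add_0_right sum_Pow_Suc
  by (rule sum_Pow_card) (auto simp: unshuffle_sum_simps simp del: image_insert)

section \<open>Pairing of vectors with functionals, and transposes of linear maps\<close>

section \<open>Linear functionals\<close>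

text \<open>Vectors are finitely supported, so every function on the basis is a functional, whatever
  its support. This is why the dual of S(W) contains all power series.\<close>

definition ev :: "('a \<Rightarrow> 'k::field) \<Rightarrow> ('a \<Rightarrow>\<^sub>0 'k) \<Rightarrow> 'k" where
  "ev g x = (\<Sum>a\<in>Poly_Mapping.keys x. Poly_Mapping.lookup x a * g a)"

lemma ev_superset:
  "finite A \<Longrightarrow> Poly_Mapping.keys x \<subseteq> A \<Longrightarrow> ev g x = (\<Sum>a\<in>A. Poly_Mapping.lookup x a * g a)"
  unfolding ev_def by (rule sum.mono_neutral_left) (auto simp: in_keys_iff)

lemma ev_zero [simp]: "ev g 0 = 0"
  by (simp add: ev_def)

lemma ev_zero_left [simp]: "ev (\<lambda>_. 0) x = 0"
  by (simp add: ev_def)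

lemma ev_basis [simp]: "ev g (basis a) = g a"
  by (simp add: ev_def)

lemma ev_add [simp]: "ev g (x + y) = ev g x + ev g y"
proof -
  have "Poly_Mapping.keys (x + y) \<subseteq> Poly_Mapping.keys x \<union> Poly_Mapping.keys y"
    by (rule Poly_Mapping.keys_add)
  then show ?thesis
    by (simp add: ev_superset[of "Poly_Mapping.keys x \<union> Poly_Mapping.keys y"] lookup_add
        distrib_right sum.distrib)
qed

lemma ev_scale [simp]: "ev g (scale c x) = c * ev g x"
proof -
  have "Poly_Mapping.keys (scale c x) \<subseteq> Poly_Mapping.keys x"
    by (auto simp: in_keys_iff)
  then show ?thesis
    by (simp add: ev_superset[of "Poly_Mapping.keys x"] sum_distrib_left mult.assoc)
qed

lemma ev_sum: "ev g (sum f A) = (\<Sum>a\<in>A. ev g (f a))"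
  by (induction A rule: infinite_finite_induct) simp_all

lemma ev_cmult_left: "ev (\<lambda>a. c * g a) x = c * ev g x"
  by (simp add: ev_def sum_distrib_left algebra_simps)

lemma ev_lin_ext: "ev g (lin_ext f x) = ev (\<lambda>a. ev g (f a)) x"
  by (simp add: lin_ext_def ev_sum) (simp add: ev_def)

lemma ev_tensor: "ev (\<lambda>(a, b). g a * h b) (tensor x y) = ev g x * ev h y"
proof -
  have "ev (\<lambda>(a, b). g a * h b) (tensor x y) = ev (\<lambda>a. ev (\<lambda>b. g a * h b) y) x"
    by (simp add: tensor_def ev_lin_ext)
  also have "\<dots> = ev (\<lambda>a. ev h y * g a) x"
    by (simp only: ev_cmult_left mult.commute)
  also have "\<dots> = ev h y * ev g x" by (rule ev_cmult_left)
  finally show ?thesis by (simp add: mult.commute)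
qed

abbreviation coord :: "'a \<Rightarrow> 'a \<Rightarrow> 'k::field" where
  "coord a \<equiv> (\<lambda>b. if b = a then 1 else 0)"

lemma ev_coord: "ev (coord a) x = Poly_Mapping.lookup x a"
  by (subst ev_superset[of "insert a (Poly_Mapping.keys x)"]) (auto simp: if_distrib in_keys_iff cong: if_cong)

lemma ev_eqI: "(\<And>g. ev g x = ev g y) \<Longrightarrow> x = y"
  by (rule poly_mapping_eqI) (metis ev_coord)

lemma linear_eq_lin_ext:
  fixes F :: "('a \<Rightarrow>\<^sub>0 'k::field) \<Rightarrow> ('b \<Rightarrow>\<^sub>0 'k)"
  assumes "is_linear F"
  shows "F = lin_ext (\<lambda>a. F (basis a))"
proof
  fix x :: "'a \<Rightarrow>\<^sub>0 'k"
  interpret Vector_Spaces.linear scale scale F by fact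
  have "x = (\<Sum>a\<in>Poly_Mapping.keys x. scale (Poly_Mapping.lookup x a) (basis a))"
    by (rule ev_eqI) (simp add: ev_sum, simp add: ev_def)
  then have "F x = F (\<Sum>a\<in>Poly_Mapping.keys x. scale (Poly_Mapping.lookup x a) (basis a))"
    by simp
  then show "F x = lin_ext (\<lambda>a. F (basis a)) x"
    by (simp add: sum scale lin_ext_def)
qed

text \<open>The transpose of \<open>F\<close>. It reverses composition, and equality of linear maps
  is tested on it.\<close>

definition pull :: "('b \<Rightarrow> 'k::field) \<Rightarrow> (('a \<Rightarrow>\<^sub>0 'k) \<Rightarrow> ('b \<Rightarrow>\<^sub>0 'k)) \<Rightarrow> 'a \<Rightarrow> 'k" where
  "pull g F = (\<lambda>a. ev g (F (basis a)))"

lemma ev_pull: "is_linear F \<Longrightarrow> ev (pull g F) x = ev g (F x)"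
  unfolding pull_def by (subst (2) linear_eq_lin_ext) (simp_all add: ev_lin_ext)

lemma pull_comp: "is_linear F \<Longrightarrow> pull g (F \<circ> G) = pull (pull g F) G"
  by (simp add: pull_def[of _ "F \<circ> G"] pull_def[of _ G] ev_pull)

lemma linear_eqI:
  assumes "is_linear F" "is_linear G" "\<And>g. pull g F = pull g G"
  shows "F = G"
proof
  fix x show "F x = G x" by (rule ev_eqI) (metis assms ev_pull)
qed

lemma is_linear_zero: "is_linear F \<Longrightarrow> F 0 = 0"
  by (metis Vector_Spaces.linear.axioms(3) module_hom.zero)

lemma is_linear_comp: "is_linear F \<Longrightarrow> is_linear G \<Longrightarrow> is_linear (F \<circ> G)"
  by (rule Vector_Spaces.linear_compose)

section \<open>Functionals on S(W) as quadruples of power series\<close>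

section \<open>Power series of functionals\<close>

lemma Rep_Mono: "i \<le> 1 \<Longrightarrow> j \<le> 1 \<Longrightarrow> 0 < i \<or> 0 < j \<or> 0 < n \<Longrightarrow> Rep_mono (Mono i j n) = (i, j, n)"
  unfolding Mono_def by (rule Abs_mono_inverse) auto

lemma mono_cases:
  obtains i j n where "I = Mono i j n" "i \<le> 1" "j \<le> 1" "0 < i \<or> 0 < j \<or> 0 < n"
proof -
  obtain i j n where e: "Rep_mono I = (i, j, n)" by (metis prod_cases3)
  then have "I = Mono i j n" by (metis Mono_def Rep_mono_inverse)
  moreover have "i \<le> 1" "j \<le> 1" "0 < i \<or> 0 < j \<or> 0 < n"
    using Rep_mono[of I] e by auto
  ultimately show thesis by (rule that)
qed

lemma letters_Mono: "i \<le> 1 \<Longrightarrow> j \<le> 1 \<Longrightarrow> 0 < i \<or> 0 < j \<or> 0 < n \<Longrightarrow> letters (Mono i j n) = sorted_word i j n"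
  by (simp add: letters_def Rep_Mono sorted_word_def)

lemma mult_basis: "mult (basis I) (basis J) = mult_mono I J"
  by (simp add: mult_def)

lemma word_Cons: "us \<noteq> [] \<Longrightarrow> word (v # us) = mult (basis (gen v)) (word us)"
  by (cases us) simp_all

lemma scale_one [simp]: "scale 1 x = x"
  by (rule poly_mapping_eqI) simp

lemma sorted_word_eq_Nil: "sorted_word i j n = [] \<longleftrightarrow> i = 0 \<and> j = 0 \<and> n = 0"
  by (auto simp: sorted_word_def)

lemma sorted_word_Suc: "sorted_word 0 0 (Suc n) = W3 # sorted_word 0 0 n"
  by (simp add: sorted_word_def)

lemma word_sorted_word:
  assumes "i \<le> 1" "j \<le> 1" "0 < i \<or> 0 < j \<or> 0 < n"
  shows "word (sorted_word i j n) = (basis (Mono i j n) :: 'k::field S)"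
proof -
  have w0: "word (sorted_word 0 0 (Suc n)) = (basis (Mono 0 0 (Suc n)) :: 'k S)" for n
  proof (induction n)
    case 0
    then show ?case by (simp add: sorted_word_def)
  next
    case (Suc n)
    then show ?case
      by (subst sorted_word_Suc)
        (simp add: word_Cons sorted_word_eq_Nil mult_basis mult_mono_def Rep_Mono)
  qed
  have w1: "word (sorted_word 0 (Suc 0) n) = (basis (Mono 0 (Suc 0) n) :: 'k S)" for n
    by (cases n)
      (simp_all add: sorted_word_simps word_Cons sorted_word_eq_Nil w0 mult_basis mult_mono_def Rep_Mono,
       simp add: sorted_word_def)
  have w2: "word (sorted_word (Suc 0) j n) = (basis (Mono (Suc 0) j n) :: 'k S)"
    if "j = 0 \<or> j = 1" for j n
    using that
    by (cases n)
      (auto simp: sorted_word_simps word_Cons sorted_word_eq_Nil w0 w1[simplified sorted_word_simps]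
         mult_basis mult_mono_def Rep_Mono,
       simp_all add: sorted_word_def)
  show ?thesis
    using assms w0[of "n - 1"] w1[of n] w2[of j n]
    by (cases "i = 0"; cases "j = 0") (auto simp: le_Suc_eq)
qed

lemma word_sorted_word':
  "i \<le> 1 \<Longrightarrow> j \<le> 1 \<Longrightarrow> word (sorted_word i j n) = (if i + j + n = 0 then 0 else basis (Mono i j n))"
  by (cases "i + j + n = 0") (simp add: sorted_word_def, auto simp: word_sorted_word)

text \<open>The algebra is reduced: there is no basis monomial with exponents \<open>(0, 0, 0)\<close>, and
  \<open>Mono 0 0 0\<close> is junk.\<close>

definition coef :: "nat \<Rightarrow> nat \<Rightarrow> (mono \<Rightarrow> 'k::field) \<Rightarrow> nat \<Rightarrow> 'k" where
  "coef i j g n = (if i + j + n = 0 then 0 else g (Mono i j n))"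

lemma coef_zero [simp]: "coef 0 0 g 0 = 0"
  by (simp add: coef_def)

lemma ev_word_sorted:
  assumes "i \<le> 1" "j \<le> 1"
  shows "ev g (word (sorted_word i j n)) = coef i j g n"
  using assms by (simp add: word_sorted_word' coef_def)

text \<open>The sign arises when \<open>W2\<close> moves past \<open>W1\<close> to its sorted place;
  the zeros are squares of odd letters.\<close>

lemma ev_word_Cons:
  assumes "i \<le> 1" "j \<le> 1"
  shows "ev g (word (W1 # sorted_word i j n)) = (if i = 0 then coef 1 j g n else 0)"
    and "ev g (word (W2 # sorted_word i j n)) = (if j = 0 then (-1) ^ i * coef i 1 g n else 0)"
    and "ev g (word (W3 # sorted_word i j n)) = coef i j g (Suc n)"
proof -
  let ?thesis' = "ev g (word (W1 # sorted_word i j n)) = (if i = 0 then coef 1 j g n else 0) \<and>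
     ev g (word (W2 # sorted_word i j n)) = (if j = 0 then (-1) ^ i * coef i 1 g n else 0) \<and>
     ev g (word (W3 # sorted_word i j n)) = coef i j g (Suc n)"
  have ?thesis'
  proof (cases "i + j + n = 0")
    case True
    then show ?thesis by (simp add: sorted_word_def coef_def)
  next
    case False
    then have "word (v # sorted_word i j n) = (mult_mono (gen v) (Mono i j n) :: 'a S)" for v
      using False assms by (simp add: word_Cons sorted_word_eq_Nil mult_basis word_sorted_word)
    then show ?thesis using assms False
      by (auto simp: mult_mono_def Rep_Mono coef_def)
  qed
  then show "ev g (word (W1 # sorted_word i j n)) = (if i = 0 then coef 1 j g n else 0)"
    and "ev g (word (W2 # sorted_word i j n)) = (if j = 0 then (-1) ^ i * coef i 1 g n else 0)"
    and "ev g (word (W3 # sorted_word i j n)) = coef i j g (Suc n)" by blast+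
qed

lemma ev_letter: "ev f (u :: 'k::field W) = Poly_Mapping.lookup u W1 * f W1 + Poly_Mapping.lookup u W2 * f W2
  + Poly_Mapping.lookup u W3 * f W3"
proof -
  have "v = W1 \<or> v = W2 \<or> v = W3" for v by (cases v) auto
  then have "Poly_Mapping.keys u \<subseteq> {W1, W2, W3}" by auto
  then show ?thesis by (subst ev_superset[of "{W1, W2, W3}"]) auto
qed

lemma ev_mult_word:
  "ev g (mult_word u us) = Poly_Mapping.lookup u W1 * ev g (word (W1 # us))
    + Poly_Mapping.lookup u W2 * ev g (word (W2 # us)) + Poly_Mapping.lookup u W3 * ev g (word (W3 # us))"
  by (simp add: mult_word_def ev_lin_ext ev_letter)

text \<open>A linear functional on \<open>S(W)\<close> is a function \<open>p + q\<theta>\<^sub>1 + r\<theta>\<^sub>2 + s\<theta>\<^sub>1\<theta>\<^sub>2\<close> on formal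
  \<open>1|2\<close>-space, with power series \<open>p, q, r, s\<close> in \<open>x\<close>; the coefficients are its values on divided
  powers, so that the transpose of the comultiplication is the product of functions.\<close>

definition series :: "nat \<Rightarrow> nat \<Rightarrow> (mono \<Rightarrow> 'k::field_char_0) \<Rightarrow> 'k fps" where
  "series i j g = Abs_fps (\<lambda>n. coef i j g n / fact n)"

lemma series_nth: "fps_nth (series i j g) n = coef i j g n / fact n"
  by (simp add: series_def)

lemma series_zero: "series i j (\<lambda>_. 0) = 0"
  by (rule fps_ext) (simp add: series_nth coef_def)

lemma series_eqI:
  assumes "series 0 0 g = series 0 0 h" "series 1 0 g = series 1 0 h"
    "series 0 1 g = series 0 1 h" "series 1 1 g = series 1 1 h"
  shows "g = h"
proof
  fix I
  obtain i j n where I: "I = Mono i j n" "i \<le> 1" "j \<le> 1" "0 < i \<or> 0 < j \<or> 0 < n" by (rule mono_cases)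
  have "series i j g = series i j h" using I assms by (auto simp: le_Suc_eq)
  then have "fps_nth (series i j g) n = fps_nth (series i j h) n" by simp
  then show "g I = h I" using I by (auto simp: series_nth coef_def)
qed

text \<open>Because \<open>series\<close> divides by factorials, the exponent shift caused by one
  more \<open>W3\<close> becomes the derivative in x.\<close>

lemma deriv_series_nth: "fps_nth (fps_deriv (series i j g)) n = coef i j g (Suc n) / fact n"
proof -
  have "(of_nat (Suc n) :: 'a) \<noteq> 0" by (rule of_nat_neq_0)
  then show ?thesis by (simp add: series_nth del: of_nat_Suc)
qed

text \<open>In the dual picture this is the coefficient function of the vector field in the
  direction of the coordinate \<open>v\<close>.\<close>

definition out :: "letter \<Rightarrow> ('k::field S \<Rightarrow> 'k W) \<Rightarrow> mono \<Rightarrow> 'k" where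
  "out v \<phi> I = Poly_Mapping.lookup (\<phi> (basis I)) v"

lemma lookup_out:
  assumes "is_linear \<phi>" "i \<le> 1" "j \<le> 1"
  shows "Poly_Mapping.lookup (\<phi> (word (sorted_word i j n))) v = coef i j (out v \<phi>) n"
  using assms by (simp add: word_sorted_word' is_linear_zero coef_def out_def)

section \<open>The transposes of comultiplication and coderivations: product of functions and odd
  vector fields\<close>

lemma series_pull_coder:
  assumes "is_linear \<phi>" "i \<le> 1" "j \<le> 1"
  shows "fps_nth (series i j (pull g (coder \<phi>))) n =
    unshuffle_sum (\<lambda>us us'. ev g (mult_word (\<phi> (word us)) us')) i j n / fact n"
proof (cases "i + j + n = 0")
  case True
  then show ?thesis
    using is_linear_zero[OF assms(1)]
    by (simp add: series_nth unshuffle_sum_def sorted_word_def ev_mult_word)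
next
  case False
  let ?H = "\<lambda>us us'. ev g (mult_word (\<phi> (word us)) us')"
  have "pull g (coder \<phi>) (Mono i j n) =
    (\<Sum>k\<in>{1..i + j + n}. \<Sum>\<sigma>\<in>Sh k (i + j + n - k). koszul \<sigma> (sorted_word i j n) *
      ?H (subword \<sigma> (sorted_word i j n) 0 k) (subword \<sigma> (sorted_word i j n) k (i + j + n)))"
    using False assms(2,3) by (simp add: pull_def coder_def letters_Mono ev_sum Let_def)
  also have "\<dots> = unshuffle_sum ?H i j n"
    by (rule sum_sum_Sh) (use assms False is_linear_zero[OF assms(1)] in \<open>auto simp: ev_mult_word\<close>)
  finally show ?thesis using False by (auto simp: series_nth coef_def)
qed

lemma series_comult:
  assumes "i \<le> 1" "j \<le> 1"
  shows "fps_nth (series i j (pull (\<lambda>(a, b). g a * h b) comult)) n =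
    unshuffle_sum (\<lambda>us us'. ev g (word us) * ev h (word us')) i j n / fact n"
proof (cases "i + j + n = 0")
  case True
  then show ?thesis
    by (simp add: series_nth unshuffle_sum_def sorted_word_def)
next
  case False
  let ?H = "\<lambda>us us'. ev g (word us) * ev h (word us')"
  have "ev (\<lambda>(a, b). g a * h b) (comult (basis (Mono i j n))) =
    (\<Sum>k\<in>{1..i + j + n - 1}. \<Sum>\<sigma>\<in>Sh k (i + j + n - k). koszul \<sigma> (sorted_word i j n) *
      ?H (subword \<sigma> (sorted_word i j n) 0 k) (subword \<sigma> (sorted_word i j n) k (i + j + n)))"
    using False assms by (simp add: comult_def letters_Mono ev_sum Let_def ev_tensor mult.assoc)
  also have "\<dots> = unshuffle_sum ?H i j n"
    by (rule sum_sum_Sh) (use assms False in auto)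
  finally show ?thesis using False by (auto simp: series_nth coef_def pull_def)
qed

text \<open>This and the next three lemmas are the components of the product of two functions p +
  q\<theta>1 + r\<theta>2 + s\<theta>1\<theta>2. The minus sign in the last one is
  \<theta>2\<theta>1 = -\<theta>1\<theta>2.\<close>

lemma series_comult_00: "series 0 0 (pull (\<lambda>(a, b). g a * h b) comult) =
   series 0 0 g * series 0 0 h"
  by (rule fps_ext, subst series_comult) (simp_all add: unshuffle_sum_00 fps_mult_nth ev_word_sorted series_nth)

lemma series_comult_10: "series 1 0 (pull (\<lambda>(a, b). g a * h b) comult) =
   series 0 0 g * series 1 0 h + series 1 0 g * series 0 0 h"
  by (rule fps_ext, subst series_comult) (simp_all add: unshuffle_sum_10[unfolded One_nat_def] fps_mult_nth ev_word_sorted series_nth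
     flip: sum.distrib add_divide_distrib)

lemma series_comult_01: "series 0 1 (pull (\<lambda>(a, b). g a * h b) comult) =
   series 0 0 g * series 0 1 h + series 0 1 g * series 0 0 h"
  by (rule fps_ext, subst series_comult) (simp_all add: unshuffle_sum_01[unfolded One_nat_def] fps_mult_nth ev_word_sorted series_nth
     flip: sum.distrib add_divide_distrib)

lemma series_comult_11: "series 1 1 (pull (\<lambda>(a, b). g a * h b) comult) =
   series 0 0 g * series 1 1 h - series 0 1 g * series 1 0 h + series 1 0 g * series 0 1 h + series 1 1 g * series 0 0 h"
  by (rule fps_ext, subst series_comult) (simp_all add: unshuffle_sum_11[unfolded One_nat_def] fps_mult_nth ev_word_sorted series_nth
     flip: sum.distrib add_divide_distrib sum_subtractf diff_divide_distrib)

text \<open>Of the twelve series of a vector field, oddness leaves six: a, a', b, b', c1 and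
  c2.\<close>

lemma odd_L_series:
  assumes "odd_L \<phi>"
  shows "series 1 0 (out W1 \<phi>) = 0" "series 0 1 (out W1 \<phi>) = 0"
    "series 1 0 (out W2 \<phi>) = 0" "series 0 1 (out W2 \<phi>) = 0"
    "series 0 0 (out W3 \<phi>) = 0" "series 1 1 (out W3 \<phi>) = 0"
proof -
  have *: "series i j (out v \<phi>) = 0" if ij: "i \<le> 1" "j \<le> 1" "odd (i + j) = odd_letter v" for i j v
  proof (rule fps_ext)
    fix n
    have "out v \<phi> (Mono i j n) = 0" if "0 < i \<or> 0 < j \<or> 0 < n"
    proof (rule ccontr)
      assume "out v \<phi> (Mono i j n) \<noteq> 0"
      then have "v \<in> Poly_Mapping.keys (\<phi> (basis (Mono i j n)))"
        by (simp add: out_def in_keys_iff)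
      then have "odd_letter v \<noteq> odd_mono (Mono i j n)"
        using assms by (simp add: odd_map_def)
      moreover have "odd_mono (Mono i j n) = odd (i + j)"
        using ij that by (simp add: odd_mono_def Rep_Mono)
      ultimately show False using ij by blast
    qed
    then show "fps_nth (series i j (out v \<phi>)) n = fps_nth 0 n"
      by (simp add: series_nth coef_def)
  qed
  show "series 1 0 (out W1 \<phi>) = 0" "series 0 1 (out W1 \<phi>) = 0"
    "series 1 0 (out W2 \<phi>) = 0" "series 0 1 (out W2 \<phi>) = 0"
    "series 0 0 (out W3 \<phi>) = 0" "series 1 1 (out W3 \<phi>) = 0"
    by (rule *; simp add: odd_letter_def)+
qed

context
  fixes \<phi> :: "'k::field_char_0 S \<Rightarrow> 'k W"
  assumes lin: "is_linear \<phi>" and odd: "odd_L \<phi>"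
begin

lemma coef_odd:
  "coef (Suc 0) 0 (out W1 \<phi>) n = 0" "coef 0 (Suc 0) (out W1 \<phi>) n = 0"
  "coef (Suc 0) 0 (out W2 \<phi>) n = 0" "coef 0 (Suc 0) (out W2 \<phi>) n = 0"
  "coef 0 0 (out W3 \<phi>) n = 0" "coef (Suc 0) (Suc 0) (out W3 \<phi>) n = 0"
  using odd_L_series[OF odd, THEN arg_cong, of "\<lambda>s. fps_nth s n"] by (simp_all add: series_nth)

text \<open>With p, q, r, s the series of \<open>g\<close>, this and the next three lemmas are the
  components of Q(p + q\<theta>1 + r\<theta>2 + s\<theta>1\<theta>2) for the vector field Q of
  \<phi>. The minus signs come from \<partial>2(\<theta>1\<theta>2) = -\<theta>1 and
  \<theta>2\<theta>1 = -\<theta>1\<theta>2.\<close>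

lemma series_coder_00: "series 0 0 (pull g (coder \<phi>)) =
   series 0 0 (out W1 \<phi>) * series 1 0 g + series 0 0 (out W2 \<phi>) * series 0 1 g"
  by (rule fps_ext, subst series_pull_coder[OF lin]) (simp_all add: unshuffle_sum_00 fps_mult_nth
    lookup_out[OF lin] coef_odd ev_mult_word ev_word_Cons series_nth add_divide_distrib sum.distrib)

lemma series_coder_10: "series 1 0 (pull g (coder \<phi>)) =
   series 1 0 (out W3 \<phi>) * fps_deriv (series 0 0 g) - series 0 0 (out W2 \<phi>) * series 1 1 g"
  by (rule fps_ext, subst series_pull_coder[OF lin]) (simp_all add: unshuffle_sum_10[unfolded One_nat_def] fps_mult_nth
    lookup_out[OF lin] coef_odd ev_mult_word ev_word_Cons series_nth deriv_series_nth add_divide_distrib diff_divide_distrib sum.distrib sum_subtractf sum_negf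
    del: fps_deriv_nth)

lemma series_coder_01: "series 0 1 (pull g (coder \<phi>)) =
   series 0 1 (out W3 \<phi>) * fps_deriv (series 0 0 g) + series 0 0 (out W1 \<phi>) * series 1 1 g"
  by (rule fps_ext, subst series_pull_coder[OF lin]) (simp_all add: unshuffle_sum_01[unfolded One_nat_def] fps_mult_nth
    lookup_out[OF lin] coef_odd ev_mult_word ev_word_Cons series_nth deriv_series_nth add_divide_distrib diff_divide_distrib sum.distrib sum_subtractf sum_negf
    del: fps_deriv_nth)

lemma series_coder_11: "series 1 1 (pull g (coder \<phi>)) =
   series 1 1 (out W1 \<phi>) * series 1 0 g + series 1 1 (out W2 \<phi>) * series 0 1 g
   + series 1 0 (out W3 \<phi>) * fps_deriv (series 0 1 g) - series 0 1 (out W3 \<phi>) * fps_deriv (series 1 0 g)"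
  by (rule fps_ext, subst series_pull_coder[OF lin]) (simp_all add: unshuffle_sum_11[unfolded One_nat_def] fps_mult_nth
    lookup_out[OF lin] coef_odd ev_mult_word ev_word_Cons series_nth deriv_series_nth add_divide_distrib diff_divide_distrib sum.distrib sum_subtractf sum_negf
    del: fps_deriv_nth)

end

section \<open>Formal coordinate changes as coalgebra automorphisms\<close>

section \<open>Coordinate changes\<close>

text \<open>Scaled so that pairing with it reads off one coefficient of \<open>series\<close>. For i
  = j = n = 0 it is 0, in accordance with the zero constant term of
  \<open>series 0 0 g\<close>.\<close>

definition divided_power :: "nat \<Rightarrow> nat \<Rightarrow> nat \<Rightarrow> 'k::field_char_0 S" where
  "divided_power i j n = scale (1 / fact n) (word (sorted_word i j n))"

lemma ev_divided_power:
  "i \<le> 1 \<Longrightarrow> j \<le> 1 \<Longrightarrow> ev g (divided_power i j n) = fps_nth (series i j g) n"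
  by (simp add: divided_power_def ev_word_sorted series_nth)

text \<open>The transpose of the substitution
  \<open>x \<mapsto> x + f\<theta>\<^sub>1\<theta>\<^sub>2, \<theta>\<^sub>1 \<mapsto> \<alpha>\<theta>\<^sub>1, \<theta>\<^sub>2 \<mapsto> \<beta>\<theta>\<^sub>1 + \<gamma>\<theta>\<^sub>2\<close>.\<close>

definition subst_map ::
    "'k::field_char_0 fps \<Rightarrow> 'k fps \<Rightarrow> 'k fps \<Rightarrow> 'k fps \<Rightarrow> 'k S \<Rightarrow> 'k S" where
  "subst_map \<alpha> \<beta> \<gamma> f = lin_ext (\<lambda>J. case Rep_mono J of (i, j, n) \<Rightarrow> scale (fact n)
     (if i = 0 \<and> j = 0 then divided_power 0 0 n
      else if j = 0 then \<Sum>k = 0..n. scale (fps_nth \<alpha> k) (divided_power 1 0 (n - k)) +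
        scale (fps_nth \<beta> k) (divided_power 0 1 (n - k))
      else if i = 0 then \<Sum>k = 0..n. scale (fps_nth \<gamma> k) (divided_power 0 1 (n - k))
      else \<Sum>k = 0..n. scale (fps_nth (\<alpha> * \<gamma>) k) (divided_power 1 1 (n - k)) +
        scale (fps_nth f k) (scale (of_nat (n - k + 1)) (divided_power 0 0 (n - k + 1)))))"

lemma is_linear_subst_map: "is_linear (subst_map \<alpha> \<beta> \<gamma> f)"
  unfolding subst_map_def by (rule linear_lin_ext)

lemma series_subst_map_00: "series 0 0 (pull g (subst_map \<alpha> \<beta> \<gamma> f)) = series 0 0 g"
proof (rule fps_ext)
  fix n show "fps_nth (series 0 0 (pull g (subst_map \<alpha> \<beta> \<gamma> f))) n = fps_nth (series 0 0 g) n"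
    by (cases "n = 0") (simp_all add: series_nth coef_def pull_def subst_map_def Rep_Mono
        divided_power_def word_sorted_word)
qed

text \<open>Taylor expansion stops after one step: p(x + f\<theta>1\<theta>2) = p + f (dp/dx)
  \<theta>1\<theta>2 because \<theta>1\<theta>2 squares to 0. In the terms with q, r and s the shift
  of x is killed by the odd factor already present.\<close>

lemma series_subst_map:
  "series 1 0 (pull g (subst_map \<alpha> \<beta> \<gamma> f)) = \<alpha> * series 1 0 g + \<beta> * series 0 1 g"
  "series 0 1 (pull g (subst_map \<alpha> \<beta> \<gamma> f)) = \<gamma> * series 0 1 g"
  "series 1 1 (pull g (subst_map \<alpha> \<beta> \<gamma> f)) = \<alpha> * \<gamma> * series 1 1 g + f * fps_deriv (series 0 0 g)"
  by (rule fps_ext, subst series_nth, simp add: fps_mult_nth[of _ "series _ _ _"]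
      fps_mult_nth[of _ "fps_deriv _"] coef_def pull_def subst_map_def Rep_Mono
      ev_sum ev_divided_power sum.distrib)+

lemma pull_id: "pull g id = g"
  by (simp add: pull_def)

lemma is_linear_id: "is_linear id"
  by (rule vector_space.linear_id[OF vector_space_scale])

text \<open>Since \<open>pull\<close> reverses composition, functionals are transformed by the
  unprimed series first and then by the primed ones; solving for the identity gives \<beta>' and
  \<open>f'\<close>. The conditions are symmetric in the two sets of series, which yields a
  two-sided inverse below.\<close>

lemma subst_map_comp_id:
  assumes "\<alpha> * \<alpha>' = 1" "\<gamma> * \<gamma>' = 1"
    and "\<beta>' = - \<alpha>' * \<gamma>' * \<beta>" "f' = - \<alpha>' * \<gamma>' * f"
  shows "subst_map \<alpha> \<beta> \<gamma> f \<circ> subst_map \<alpha>' \<beta>' \<gamma>' f' = id"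
proof (rule linear_eqI)
  fix g :: "mono \<Rightarrow> 'a"
  show "pull g (subst_map \<alpha> \<beta> \<gamma> f \<circ> subst_map \<alpha>' \<beta>' \<gamma>' f') = pull g id"
    unfolding pull_comp[OF is_linear_subst_map] pull_id
  proof (rule series_eqI; unfold series_subst_map_00 series_subst_map)
    show "\<alpha>' * (\<alpha> * series 1 0 g + \<beta> * series 0 1 g) + \<beta>' * (\<gamma> * series 0 1 g) = series 1 0 g"
      using assms by algebra
    show "\<gamma>' * (\<gamma> * series 0 1 g) = series 0 1 g"
      using assms by algebra
    show "\<alpha>' * \<gamma>' * (\<alpha> * \<gamma> * series 1 1 g + f * fps_deriv (series 0 0 g)) +
      f' * fps_deriv (series 0 0 g) = series 1 1 g"
      using assms by algebra
  qed simp
qed (intro is_linear_comp is_linear_subst_map is_linear_id)+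

lemma bij_subst_map:
  assumes "\<alpha> * \<alpha>' = 1" "\<gamma> * \<gamma>' = 1"
  shows "bij (subst_map \<alpha> \<beta> \<gamma> f)"
proof (rule o_bij)
  let ?G' = "subst_map \<alpha>' (- \<alpha>' * \<gamma>' * \<beta>) \<gamma>' (- \<alpha>' * \<gamma>' * f)"
  show "subst_map \<alpha> \<beta> \<gamma> f \<circ> ?G' = id"
    by (rule subst_map_comp_id) (use assms in auto)
  show "?G' \<circ> subst_map \<alpha> \<beta> \<gamma> f = id"
  proof (rule subst_map_comp_id)
    show "\<alpha>' * \<alpha> = 1" "\<gamma>' * \<gamma> = 1" using assms by (simp_all add: mult.commute)
    show "\<beta> = - \<alpha> * \<gamma> * (- \<alpha>' * \<gamma>' * \<beta>)" using assms by algebra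
    show "f = - \<alpha> * \<gamma> * (- \<alpha>' * \<gamma>' * f)" using assms by algebra
  qed
qed

lemma ev_tensor_map:
  "ev (\<lambda>(a, b). g a * h b) (tensor_map F G y) = ev (\<lambda>(a, b). pull g F a * pull h G b) y"
  unfolding tensor_map_def ev_lin_ext
  by (rule arg_cong[where f = "\<lambda>f. ev f y"]) (auto simp: fun_eq_iff ev_tensor pull_def)

lemma is_linear_comult: "is_linear comult"
  unfolding comult_def by (rule linear_lin_ext)

lemma is_linear_coder: "is_linear (coder \<phi>)"
  unfolding coder_def by (rule linear_lin_ext)

text \<open>Substitution is multiplicative on functions, and the transpose of this is compatibility
  with the comultiplication.\<close>

lemma comult_subst_map:
  "comult (subst_map \<alpha> \<beta> \<gamma> f x) = tensor_map (subst_map \<alpha> \<beta> \<gamma> f) (subst_map \<alpha> \<beta> \<gamma> f) (comult x)"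
  (is "comult (?G x) = _")
proof (rule poly_mapping_eqI)
  fix p :: "mono \<times> mono"
  obtain I K where p: "p = (I, K)" by (cases p)
  let ?g = "coord I :: mono \<Rightarrow> 'a" and ?h = "coord K :: mono \<Rightarrow> 'a"
  \<comment> \<open>Every coordinate functional on the tensor square is a product functional, so
    testing on these is enough.\<close>
  have c: "coord p = (\<lambda>(a, b). ?g a * ?h b)" by (auto simp: p fun_eq_iff)
  have "pull (pull (\<lambda>(a, b). ?g a * ?h b) comult) ?G =
      pull (\<lambda>(a, b). pull ?g ?G a * pull ?h ?G b) comult"
    by (rule series_eqI; unfold series_subst_map_00 series_subst_map
        series_comult_00 series_comult_10 series_comult_01 series_comult_11)
      (simp_all add: algebra_simps)
  then have "ev (\<lambda>(a, b). ?g a * ?h b) (comult (?G x)) =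
      ev (\<lambda>(a, b). ?g a * ?h b) (tensor_map ?G ?G (comult x))"
    unfolding ev_tensor_map by (simp flip: ev_pull[OF is_linear_comult] ev_pull[OF is_linear_subst_map])
  then show "Poly_Mapping.lookup (comult (?G x)) p =
    Poly_Mapping.lookup (tensor_map ?G ?G (comult x)) p"
    by (simp flip: ev_coord add: c)
qed

lemma odd_mono_Mono:
  "i \<le> 1 \<Longrightarrow> j \<le> 1 \<Longrightarrow> 0 < i \<or> 0 < j \<or> 0 < n \<Longrightarrow> odd_mono (Mono i j n) \<longleftrightarrow> odd (i + j)"
  by (simp add: odd_mono_def Rep_Mono)

lemma series_coord_eq_0:
  assumes "i \<le> 1" "j \<le> 1" "odd_mono I \<noteq> odd (i + j)"
  shows "series i j (coord I) = 0"
proof (rule fps_ext)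
  fix n
  have "Mono i j n \<noteq> I" if "0 < i \<or> 0 < j \<or> 0 < n"
    using assms odd_mono_Mono[OF assms(1,2) that] by auto
  then show "fps_nth (series i j (coord I)) n = fps_nth 0 n"
    by (auto simp: series_nth coef_def)
qed

text \<open>A coefficient between monomials of different parity would be read off by
  \<open>coord I\<close>, whose series of the other parity vanish; the substitution does not mix the
  parities.\<close>

lemma even_map_subst_map: "even_map odd_mono odd_mono (subst_map \<alpha> \<beta> \<gamma> f)"
  unfolding even_map_def
proof (intro allI ballI, rule ccontr)
  fix J I
  let ?h = "pull (coord I) (subst_map \<alpha> \<beta> \<gamma> f)"
  assume "I \<in> Poly_Mapping.keys (subst_map \<alpha> \<beta> \<gamma> f (basis J))" and par: "odd_mono I \<noteq> odd_mono J"
  then have nz: "?h J \<noteq> 0" by (simp add: pull_def ev_coord in_keys_iff)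
  obtain i j n where J: "J = Mono i j n" "i \<le> 1" "j \<le> 1" "0 < i \<or> 0 < j \<or> 0 < n"
    by (rule mono_cases)
  then have "fps_nth (series i j ?h) n \<noteq> 0" using nz by (auto simp: series_nth coef_def)
  moreover have "odd_mono I \<noteq> odd (i + j)" using par J odd_mono_Mono by simp
  then have "series i j ?h = 0"
    using J series_coord_eq_0[of 0 0 I] series_coord_eq_0[of 1 0 I] series_coord_eq_0[of 0 1 I]
      series_coord_eq_0[of 1 1 I]
    by (auto simp: le_Suc_eq series_subst_map_00 series_subst_map[unfolded One_nat_def])
  ultimately show False by simp
qed

text \<open>Composing the conjugation formula with the automorphism removes the inverse and leaves
  an equation that can be tested on functionals.\<close>

lemma equivalentI:
  assumes "\<alpha> * \<alpha>' = 1" "\<gamma> * \<gamma>' = 1"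
    and comm: "subst_map \<alpha> \<beta> \<gamma> f \<circ> coder d' = coder d \<circ> subst_map \<alpha> \<beta> \<gamma> f"
  shows "equivalent d d'"
proof -
  let ?G = "subst_map \<alpha> \<beta> \<gamma> f"
  have bij: "bij ?G" by (rule bij_subst_map) fact+
  have "coder d' = inv ?G \<circ> (?G \<circ> coder d')"
    using bij by (simp add: o_assoc bij_is_inj)
  then have "coder d' = inv ?G \<circ> coder d \<circ> ?G" by (simp add: comm o_assoc)
  then show ?thesis
    unfolding equivalent_def coalgebra_automorphism_def
    using bij is_linear_subst_map comult_subst_map even_map_subst_map by blast
qed

section \<open>The equation Q^2 = 0 and reduction to a normal form\<close>

section \<open>Square-zero odd vector fields\<close>

lemma out_eq_pull: "out v \<phi> = pull (coord v) \<phi>"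
  by (simp add: out_def pull_def ev_coord fun_eq_iff)

text \<open>For odd \<open>d\<close> the bracket with itself is twice the composite of
  \<open>d\<close> with \<open>coder d\<close>, and 2 is invertible. Dually, \<open>out v d\<close>
  is Q applied to the coordinate \<open>v\<close>, so Q^2 is tested on the three
  coordinates.\<close>

lemma bracket_self_eq_0_iff:
  fixes d :: "'k::field_char_0 S \<Rightarrow> 'k W"
  assumes "is_linear d" "odd_L d"
  shows "bracket d d = (\<lambda>x. 0) \<longleftrightarrow> (\<forall>v. pull (out v d) (coder d) = (\<lambda>_. 0))"
proof -
  have "bracket d d x = 0 \<longleftrightarrow> d (coder d x) = 0" for x
  proof -
    have "bracket d d x = scale 2 (d (coder d x))"
      by (rule poly_mapping_eqI) (simp add: bracket_def assms lookup_minus)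
    moreover have "scale 2 y = 0 \<longleftrightarrow> y = 0" for y :: "'k W"
      by (simp add: poly_mapping_eq_iff fun_eq_iff)
    ultimately show ?thesis by simp
  qed
  moreover have "d (coder d x) = 0 \<longleftrightarrow> (\<forall>v. ev (pull (out v d) (coder d)) x = 0)" for x
    unfolding ev_pull[OF is_linear_coder] out_eq_pull ev_pull[OF assms(1)]
    by (simp add: ev_coord poly_mapping_eq_iff fun_eq_iff)
  ultimately show ?thesis
    unfolding fun_eq_iff by (metis ev_basis ev_zero_left ext)
qed

text \<open>The first two equations are the \<theta>1- and \<theta>2-coefficients of Q^2\<theta>1 =
  0, the next two those of Q^2\<theta>2 = 0, and the last is the part of Q^2x = 0 free of \<theta>1
  and \<theta>2. Primes mark \<theta>1\<theta>2-coefficients, not derivatives.\<close>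

lemma codifferential_series:
  fixes d :: "'k::field_char_0 S \<Rightarrow> 'k W"
  assumes "codifferential d"
  defines "a \<equiv> series 0 0 (out W1 d)" and "a' \<equiv> series 1 1 (out W1 d)"
    and "b \<equiv> series 0 0 (out W2 d)" and "b' \<equiv> series 1 1 (out W2 d)"
    and "c1 \<equiv> series 1 0 (out W3 d)" and "c2 \<equiv> series 0 1 (out W3 d)"
  shows "c1 * fps_deriv a = b * a'" "c2 * fps_deriv a + a * a' = 0"
    "c1 * fps_deriv b = b * b'" "c2 * fps_deriv b + a * b' = 0" "a * c1 + b * c2 = 0"
proof -
  from assms(1) have lin: "is_linear d" and odd: "odd_L d" and "bracket d d = (\<lambda>x. 0)"
    by (auto simp: codifferential_def)
  then have "pull (out v d) (coder d) = (\<lambda>_. 0)" for v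
    by (simp add: bracket_self_eq_0_iff)
  then have z: "series i j (pull (out v d) (coder d)) = 0" for i j v by (simp add: series_zero)
  note odd_0 = odd_L_series[OF odd, unfolded One_nat_def]
  show "c1 * fps_deriv a = b * a'"
    using series_coder_10[OF lin odd, of "out W1 d"] by (simp add: z assms)
  show "c2 * fps_deriv a + a * a' = 0"
    using series_coder_01[OF lin odd, of "out W1 d"] by (simp add: z assms)
  show "c1 * fps_deriv b = b * b'"
    using series_coder_10[OF lin odd, of "out W2 d"] by (simp add: z assms)
  show "c2 * fps_deriv b + a * b' = 0"
    using series_coder_01[OF lin odd, of "out W2 d"] by (simp add: z assms)
  show "a * c1 + b * c2 = 0"
    using series_coder_00[OF lin odd, of "out W3 d"] by (simp add: z assms)
qed

lemma odd_LI:
  assumes "series 1 0 (out W1 \<phi>) = 0" "series 0 1 (out W1 \<phi>) = 0"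
    "series 1 0 (out W2 \<phi>) = 0" "series 0 1 (out W2 \<phi>) = 0"
    "series 0 0 (out W3 \<phi>) = 0" "series 1 1 (out W3 \<phi>) = 0"
  shows "odd_L \<phi>"
  unfolding odd_map_def
proof (intro allI ballI, rule notI)
  fix J v
  assume "v \<in> Poly_Mapping.keys (\<phi> (basis J))" and par: "odd_letter v = odd_mono J"
  then have nz: "out v \<phi> J \<noteq> 0" by (simp add: out_def in_keys_iff)
  obtain i j n where J: "J = Mono i j n" "i \<le> 1" "j \<le> 1" "0 < i \<or> 0 < j \<or> 0 < n"
    by (rule mono_cases)
  then have "fps_nth (series i j (out v \<phi>)) n \<noteq> 0" using nz by (auto simp: series_nth coef_def)
  moreover have "odd_letter v = odd (i + j)" using par J odd_mono_Mono by simp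
  then have "series i j (out v \<phi>) = 0"
    using J(2,3) assms by (cases v) (auto simp: le_Suc_eq odd_letter_def)
  ultimately show False by simp
qed

text \<open>With b = b' = c1 = 0 the only condition left from Q^2 = 0 is the \<theta>2-coefficient
  of Q^2\<theta>1, which is the assumed equation.\<close>

lemma normal_form_codifferential:
  fixes d :: "'k::field_char_0 S \<Rightarrow> 'k W"
  assumes "is_linear d" and odd: "odd_L d"
    and 0: "series 0 0 (out W2 d) = 0" "series 1 1 (out W2 d) = 0" "series 1 0 (out W3 d) = 0"
    and eq: "series 0 1 (out W3 d) * fps_deriv (series 0 0 (out W1 d)) +
      series 0 0 (out W1 d) * series 1 1 (out W1 d) = 0"
  shows "codifferential d"
proof -
  have "pull (out v d) (coder d) = (\<lambda>_. 0)" for v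
    by (rule series_eqI; unfold series_coder_00[OF assms(1,2)] series_coder_10[OF assms(1,2)]
        series_coder_01[OF assms(1,2)] series_coder_11[OF assms(1,2)] series_zero; cases v)
      (use eq in \<open>simp_all add: 0[unfolded One_nat_def] odd_L_series[OF odd, unfolded One_nat_def]\<close>)
  then show ?thesis using assms by (simp add: codifferential_def bracket_self_eq_0_iff)
qed

text \<open>The \<theta>1\<theta>2-component of the relation to be checked in
  \<open>equivalent_normal_form\<close>, with d prefixed for derivatives. Both sides carry a factor
  \<open>A\<close> because Q^2 = 0 controls \<open>a'\<close>, \<open>b'\<close> and
  \<open>A'\<close> only after multiplication by \<open>A\<close>.\<close>

lemma intertwining_identity:
  fixes A A' C \<alpha> \<beta> \<gamma> f c1 c2 a' b' q r dA d\<alpha> d\<beta> dq dr :: "'a::comm_ring_1"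
  assumes c: "C + A * f = \<gamma> * c2"
    and a: "c2 * (A * d\<alpha> + dA * \<alpha>) + A * \<alpha> * a' = 0"
    and b: "c2 * (A * d\<beta> + dA * \<beta>) + A * \<alpha> * b' = 0"
    and E: "C * dA + A * A' = 0"
    and n: "\<alpha> * c1 + \<beta> * c2 = 0"
  shows "A * (A' * (\<alpha> * q + \<beta> * r) + 0 * (\<gamma> * r) + 0 * (\<gamma> * dr + d\<gamma> * r) -
      C * ((\<alpha> * dq + d\<alpha> * q) + (\<beta> * dr + d\<beta> * r))) =
    A * (\<alpha> * \<gamma> * (a' * q + b' * r + c1 * dr - c2 * dq) +
      f * ((A * \<alpha> * dq + (A * d\<alpha> + dA * \<alpha>) * q) + (A * \<beta> * dr + (A * d\<beta> + dA * \<beta>) * r)))"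
proof -
  have C: "C = \<gamma> * c2 - A * f" using c by (simp add: algebra_simps eq_diff_eq)
  \<comment> \<open>Used for \<open>x = \<alpha>\<close>, \<open>y = a'\<close> and for
    \<open>x = \<beta>\<close>, \<open>y = b'\<close>: the coefficients of \<open>q\<close> and
    \<open>r\<close> have the same form.\<close>
  have *: "A * A' * x - A * C * dx = A * \<alpha> * \<gamma> * y + A * f * (A * dx + dA * x)"
    if "c2 * (A * dx + dA * x) + A * \<alpha> * y = 0" for x y dx
  proof -
    have y: "A * \<alpha> * y = - (c2 * (A * dx + dA * x))" using that by (simp add: eq_neg_iff_add_eq_0 add.commute)
    have A': "A * A' = - (C * dA)" using E by (simp add: eq_neg_iff_add_eq_0 add.commute)
    have t: "A * \<alpha> * \<gamma> * y = \<gamma> * - (c2 * (A * dx + dA * x))"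
      unfolding y[symmetric] by (simp only: mult_ac)
    show ?thesis unfolding t A' C by (simp add: algebra_simps)
  qed
  \<comment> \<open>This handles the coefficient of \<open>dr\<close>, where \<open>n\<close> trades
    \<open>\<beta> * c2\<close> for \<open>\<alpha> * c1\<close>.\<close>
  have dr: "- (C * \<beta>) = \<alpha> * \<gamma> * c1 + f * A * \<beta>"
  proof -
    have "\<alpha> * c1 = - (\<beta> * c2)" using n by (simp add: eq_neg_iff_add_eq_0)
    moreover have "\<alpha> * \<gamma> * c1 = \<gamma> * (\<alpha> * c1)" by (simp add: ac_simps)
    ultimately show ?thesis unfolding C by (simp add: algebra_simps)
  qed
  have "A * (A' * (\<alpha> * q + \<beta> * r) + 0 * (\<gamma> * r) + 0 * (\<gamma> * dr + d\<gamma> * r) -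
      C * ((\<alpha> * dq + d\<alpha> * q) + (\<beta> * dr + d\<beta> * r))) =
    (A * A' * \<alpha> - A * C * d\<alpha>) * q + (A * A' * \<beta> - A * C * d\<beta>) * r - A * C * \<alpha> * dq + A * (- (C * \<beta>)) * dr"
    by (simp add: algebra_simps)
  also have "\<dots> = (A * \<alpha> * \<gamma> * a' + A * f * (A * d\<alpha> + dA * \<alpha>)) * q
      + (A * \<alpha> * \<gamma> * b' + A * f * (A * d\<beta> + dA * \<beta>)) * r
      - A * (\<gamma> * c2 - A * f) * \<alpha> * dq + A * (\<alpha> * \<gamma> * c1 + f * A * \<beta>) * dr"
    unfolding *[OF a] *[OF b] dr unfolding C ..
  also have "\<dots> = A * (\<alpha> * \<gamma> * (a' * q + b' * r + c1 * dr - c2 * dq) +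
      f * ((A * \<alpha> * dq + (A * d\<alpha> + dA * \<alpha>) * q) + (A * \<beta> * dr + (A * d\<beta> + dA * \<beta>) * r)))"
    by (simp add: algebra_simps)
  finally show ?thesis .
qed

text \<open>The assumptions \<open>a\<close>, \<open>b\<close> and \<open>c\<close> compare the two
  vector fields on \<theta>1, \<theta>2 and x in lowest order in the odd variables. The series a',
  b' and c1 of \<open>d\<close> then match automatically, since Q^2 = 0 determines them once the
  first series of \<open>d'\<close> is nonzero.\<close>

lemma equivalent_normal_form:
  fixes d d' :: "'k::field_char_0 S \<Rightarrow> 'k W"
  assumes d: "codifferential d" and d': "codifferential d'"
    and 0: "series 0 0 (out W2 d') = 0" "series 1 1 (out W2 d') = 0" "series 1 0 (out W3 d') = 0"
    and nz: "series 0 0 (out W1 d') \<noteq> 0"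
    and a: "series 0 0 (out W1 d) = series 0 0 (out W1 d') * \<alpha>"
    and b: "series 0 0 (out W2 d) = series 0 0 (out W1 d') * \<beta>"
    and c: "series 0 1 (out W3 d') + series 0 0 (out W1 d') * f = \<gamma> * series 0 1 (out W3 d)"
    and inv: "fps_nth \<alpha> 0 \<noteq> 0" "fps_nth \<gamma> 0 \<noteq> 0"
  shows "equivalent d d'"
proof (rule equivalentI)
  show "\<alpha> * inverse \<alpha> = 1" "\<gamma> * inverse \<gamma> = 1"
    by (intro inverse_mult_eq_1' inv)+
  from d d' have lin: "is_linear d" "is_linear d'" and odd: "odd_L d" "odd_L d'"
    by (auto simp: codifferential_def)
  let ?A = "series 0 0 (out W1 d')" and ?A' = "series 1 1 (out W1 d')"
  let ?C = "series 0 1 (out W3 d')"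
  let ?a' = "series 1 1 (out W1 d)" and ?b' = "series 1 1 (out W2 d)"
  let ?c1 = "series 1 0 (out W3 d)" and ?c2 = "series 0 1 (out W3 d)"
  note e = codifferential_series[OF d, unfolded a b fps_deriv_mult]
  note E = codifferential_series(2)[OF d']
  show "subst_map \<alpha> \<beta> \<gamma> f \<circ> coder d' = coder d \<circ> subst_map \<alpha> \<beta> \<gamma> f"
  proof (rule linear_eqI)
    fix g :: "mono \<Rightarrow> 'k"
    let ?p = "series 0 0 g" and ?q = "series 1 0 g" and ?r = "series 0 1 g" and ?s = "series 1 1 g"
    show "pull g (subst_map \<alpha> \<beta> \<gamma> f \<circ> coder d') = pull g (coder d \<circ> subst_map \<alpha> \<beta> \<gamma> f)"
      unfolding pull_comp[OF is_linear_subst_map] pull_comp[OF is_linear_coder]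
    proof (rule series_eqI; unfold series_subst_map_00 series_subst_map 0 a b
        series_coder_00[OF lin(1) odd(1)] series_coder_00[OF lin(2) odd(2)]
        series_coder_10[OF lin(1) odd(1)] series_coder_10[OF lin(2) odd(2)]
        series_coder_01[OF lin(1) odd(1)] series_coder_01[OF lin(2) odd(2)]
        series_coder_11[OF lin(1) odd(1)] series_coder_11[OF lin(2) odd(2)])
      \<comment> \<open>The equation a c1 + b c2 = 0 with the factor \<open>?A\<close> cancelled,
        power series over a field being an integral domain.\<close>
      have n: "\<alpha> * ?c1 + \<beta> * ?c2 = 0"
      proof -
        have "?A * (\<alpha> * ?c1 + \<beta> * ?c2) = 0" using e(5) by algebra
        then show ?thesis using nz by simp
      qed
      show "?A * (\<alpha> * ?q + \<beta> * ?r) + 0 * (\<gamma> * ?r) = ?A * \<alpha> * ?q + ?A * \<beta> * ?r"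
        by (simp add: algebra_simps)
      show "0 * fps_deriv ?p - 0 * (\<alpha> * \<gamma> * ?s + f * fps_deriv ?p) =
        \<alpha> * (?c1 * fps_deriv ?p - ?A * \<beta> * ?s) + \<beta> * (?c2 * fps_deriv ?p + ?A * \<alpha> * ?s)"
      proof -
        have "\<alpha> * (?c1 * fps_deriv ?p - ?A * \<beta> * ?s) + \<beta> * (?c2 * fps_deriv ?p + ?A * \<alpha> * ?s) =
          (\<alpha> * ?c1 + \<beta> * ?c2) * fps_deriv ?p"
          by (simp add: algebra_simps)
        then show ?thesis by (simp only: n mult_zero_left diff_zero)
      qed
      show "?C * fps_deriv ?p + ?A * (\<alpha> * \<gamma> * ?s + f * fps_deriv ?p) =
        \<gamma> * (?c2 * fps_deriv ?p + ?A * \<alpha> * ?s)"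
      proof -
        have "?C * fps_deriv ?p + ?A * (\<alpha> * \<gamma> * ?s + f * fps_deriv ?p) =
          (?C + ?A * f) * fps_deriv ?p + \<alpha> * \<gamma> * ?A * ?s"
          by (simp add: algebra_simps)
        then show ?thesis unfolding c by (simp add: algebra_simps)
      qed
      have "?A * (?A' * (\<alpha> * ?q + \<beta> * ?r) + 0 * (\<gamma> * ?r) + 0 * fps_deriv (\<gamma> * ?r) -
          ?C * fps_deriv (\<alpha> * ?q + \<beta> * ?r)) =
        ?A * (\<alpha> * \<gamma> * (?a' * ?q + ?b' * ?r + ?c1 * fps_deriv ?r - ?c2 * fps_deriv ?q) +
        f * fps_deriv (?A * \<alpha> * ?q + ?A * \<beta> * ?r))"
        unfolding fps_deriv_add fps_deriv_mult by (rule intertwining_identity[OF c e(2,4) E n])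
      then show "?A' * (\<alpha> * ?q + \<beta> * ?r) + 0 * (\<gamma> * ?r) + 0 * fps_deriv (\<gamma> * ?r) -
          ?C * fps_deriv (\<alpha> * ?q + \<beta> * ?r) =
        \<alpha> * \<gamma> * (?a' * ?q + ?b' * ?r + ?c1 * fps_deriv ?r - ?c2 * fps_deriv ?q) +
        f * fps_deriv (?A * \<alpha> * ?q + ?A * \<beta> * ?r)"
        using nz by simp
    qed
  qed (intro is_linear_comp is_linear_subst_map is_linear_coder)+
qed

section \<open>The two normal forms and their extensions\<close>

section \<open>The two codifferentials\<close>

lemma out_phi:
  "out v (phi i j n w) = (\<lambda>I. if v = w \<and> I = Mono i j n then fact i * fact j * fact n else 0)"
  by (auto simp: out_def phi_def fun_eq_iff when_def lookup_single)

lemma Mono_eq_iff: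
  assumes "i \<le> 1" "j \<le> 1" "0 < i \<or> 0 < j \<or> 0 < n" "i' \<le> 1" "j' \<le> 1" "0 < i' \<or> 0 < j' \<or> 0 < n'"
  shows "Mono i j n = Mono i' j' n' \<longleftrightarrow> i = i' \<and> j = j' \<and> n = n'"
  by (metis Rep_Mono[OF assms(1-3)] Rep_Mono[OF assms(4-6)] prod.inject)

text \<open>The factorials in \<open>phi\<close> cancel those in \<open>series\<close>, which leaves
  a pure power of x.\<close>

lemma series_out_phi:
  assumes "i \<le> 1" "j \<le> 1" "0 < i \<or> 0 < j \<or> 0 < n" "i' \<le> 1" "j' \<le> 1"
  shows "series i' j' (out v (phi i j n w)) = (if v = w \<and> i' = i \<and> j' = j then fps_X ^ n else 0)"
proof (rule fps_ext)
  fix k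
  have "fact i = (1 :: 'a)" "fact j = (1 :: 'a)" using assms(1,2) by (auto simp: le_Suc_eq)
  then have coef: "coef i' j' (out v (phi i j n w)) k =
      (if v = w \<and> 0 < i' + j' + k \<and> Mono i' j' k = Mono i j n then fact n else (0 :: 'a))"
    by (simp add: coef_def out_phi)
  show "fps_nth (series i' j' (out v (phi i j n w))) k =
    fps_nth (if v = w \<and> i' = i \<and> j' = j then fps_X ^ n else 0 :: 'a fps) k"
  proof (cases "0 < i' + j' + k")
    case True
    then have "Mono i' j' k = Mono i j n \<longleftrightarrow> i' = i \<and> j' = j \<and> k = n"
      by (intro Mono_eq_iff assms) auto
    then show ?thesis using True unfolding series_nth coef by auto
  next
    case False
    then show ?thesis using assms(3) unfolding series_nth coef by auto
  qed
qed

lemma is_linear_phi: "is_linear (phi i j n v)"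
  by (auto simp: Vector_Spaces.linear_iff vector_space_scale phi_def lookup_add algebra_simps
      intro!: poly_mapping_eqI)

lemma series_d_star:
  assumes "i \<le> 1" "j \<le> 1"
  shows "series i j (out v (d_star m)) = (if v = W1 \<and> i = 0 \<and> j = 0 then fps_X ^ (m + 2) else 0)"
  unfolding d_star_def by (subst series_out_phi) (use assms in auto)

lemma series_d_sharp:
  fixes v :: letter
  assumes "i \<le> 1" "j \<le> 1"
  shows "series i j (out v (d_sharp m :: 'k::field_char_0 S \<Rightarrow> 'k W)) =
    (if v = W3 \<and> i = 0 \<and> j = 1 then fps_X ^ (m + 1)
     else if v = W1 \<and> i = 0 \<and> j = 0 then fps_X ^ (m + 2)
     else if v = W1 \<and> i = 1 \<and> j = 1 then - (fps_const (of_nat (m + 2)) * fps_X ^ m) else 0)"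
proof -
  define c where "c = (of_nat (m + 2) :: 'k)"
  have "series i j (out v (d_sharp m :: 'k S \<Rightarrow> 'k W)) =
    series i j (out v (phi 0 1 (m + 1) W3)) + series i j (out v (phi 0 0 (m + 2) W1))
    - fps_const c * series i j (out v (phi 1 1 m W1))"
  proof (rule fps_ext)
    fix n
    have "out v (d_sharp m) I = out v (phi 0 1 (m + 1) W3) I + out v (phi 0 0 (m + 2) W1) I
      - c * out v (phi 1 1 m W1) I" for I
      by (simp only: out_def d_sharp_def c_def lookup_add lookup_minus lookup_scale)
    then show "fps_nth (series i j (out v (d_sharp m :: 'k S \<Rightarrow> 'k W))) n =
      fps_nth (series i j (out v (phi 0 1 (m + 1) W3)) + series i j (out v (phi 0 0 (m + 2) W1))
        - fps_const c * series i j (out v (phi 1 1 m W1))) n"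
      by (simp only: series_nth coef_def fps_add_nth fps_sub_nth fps_mult_left_const_nth)
        (simp add: add_divide_distrib diff_divide_distrib)
  qed
  then show ?thesis
    unfolding c_def[symmetric] using assms by (simp add: series_out_phi)
qed

lemma codifferential_d_star: "codifferential (d_star m)"
proof (rule normal_form_codifferential)
  show "is_linear (d_star m)" unfolding d_star_def by (rule is_linear_phi)
  show "odd_L (d_star m)" by (rule odd_LI) (simp_all add: series_d_star)
qed (simp_all add: series_d_star)

text \<open>With a = x^(m + 2) and c2 = x^(m + 1), the equation c2 (da/dx) + a a' = 0 forces a' =
  -(m + 2) x^m; this explains the third term of \<open>d_sharp\<close>.\<close>

lemma codifferential_d_sharp: "codifferential (d_sharp m :: 'a::field_char_0 S \<Rightarrow> 'a W)"
proof (rule normal_form_codifferential)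
  show "is_linear (d_sharp m)"
    by (auto simp: Vector_Spaces.linear_iff vector_space_scale d_sharp_def phi_def lookup_add
        lookup_minus algebra_simps intro!: poly_mapping_eqI)
  show "odd_L (d_sharp m)" by (rule odd_LI) (simp_all add: series_d_sharp)
  have A: "series 0 0 (out W1 (d_sharp m)) = (fps_X ^ (m + 2) :: 'a fps)"
    and A': "series 1 1 (out W1 (d_sharp m)) = - (fps_const (of_nat (m + 2)) * fps_X ^ m :: 'a fps)"
    and C: "series 0 1 (out W3 (d_sharp m)) = (fps_X ^ (m + 1) :: 'a fps)"
    by (subst series_d_sharp; simp)+
  have D: "fps_deriv (fps_X ^ (m + 2)) = fps_const (of_nat (m + 2)) * (fps_X ^ (m + 1) :: 'a fps)"
    unfolding fps_deriv_power by simp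
  have "fps_X ^ (m + 1) * fps_X ^ (m + 1) = (fps_X ^ (m + 2) * fps_X ^ m :: 'a fps)"
    unfolding power_add[symmetric] by (rule arg_cong[where f = "power fps_X"]) simp
  moreover have "p * p = q * r \<Longrightarrow> p * (c * p) + q * - (c * r) = 0" for c p q r :: "'a fps"
    by algebra
  ultimately have "fps_X ^ (m + 1) * (c * fps_X ^ (m + 1)) + fps_X ^ (m + 2) * - (c * fps_X ^ m) = 0"
    for c :: "'a fps" by blast
  then show "series 0 1 (out W3 (d_sharp m)) * fps_deriv (series 0 0 (out W1 (d_sharp m))) +
      series 0 0 (out W1 (d_sharp m)) * series 1 1 (out W1 (d_sharp m :: 'a S \<Rightarrow> 'a W)) = 0"
    unfolding A A' C D .
qed (simp_all add: series_d_sharp)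

lemma coef_out_component:
  assumes "i \<le> 1" "j \<le> 1"
  shows "coef i j (out v (component (i + j + n) d)) n = coef i j (out v d) n"
  using assms by (auto simp: coef_def out_def component_def deg_def Rep_Mono)

text \<open>The degree counts odd letters too. So a and b are divisible by x^N, while c2 is only
  known to be divisible by x^(N - 1).\<close>

lemma extension_series:
  assumes "is_extension N dN d" "i \<le> 1" "j \<le> 1"
  shows "i + j + n < N \<Longrightarrow> fps_nth (series i j (out v d)) n = 0"
    and "i + j + n = N \<Longrightarrow> fps_nth (series i j (out v d)) n = fps_nth (series i j (out v dN)) n"
proof -
  have c: "fps_nth (series i j (out v d)) n = coef i j (out v (component (i + j + n) d)) n / fact n"
    using assms by (simp add: series_nth coef_out_component)
  show "i + j + n < N \<Longrightarrow> fps_nth (series i j (out v d)) n = 0"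
    unfolding c using assms(1) by (simp add: is_extension_def coef_def out_def)
  show "i + j + n = N \<Longrightarrow> fps_nth (series i j (out v d)) n = fps_nth (series i j (out v dN)) n"
    unfolding c using assms(1) by (simp add: is_extension_def series_nth)
qed

lemma fps_eq_X_power_mult_shift:
  assumes "\<And>k. k < n \<Longrightarrow> fps_nth F k = 0"
  shows "F = fps_X ^ n * fps_shift n F"
  by (rule fps_ext) (simp add: fps_X_power_mult_nth assms)

theorem mainTheorem4:
  fixes m :: nat
  shows "codifferential (d_star m :: 'k::{alg_closed_field, field_char_0} S \<Rightarrow> 'k W) \<and>
    codifferential (d_sharp m :: 'k S \<Rightarrow> 'k W) \<and>
    (\<forall>d :: 'k S \<Rightarrow> 'k W. is_extension (m + 2) (d_star m) d \<longrightarrow> equivalent d (d_star m)) \<and>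
    (\<forall>d :: 'k S \<Rightarrow> 'k W. is_extension (m + 2) (d_sharp m) d \<longrightarrow> equivalent d (d_sharp m))"
proof (intro conjI allI impI codifferential_d_star codifferential_d_sharp)
  fix d :: "'k S \<Rightarrow> 'k W"
  let ?a = "series 0 0 (out W1 d)" and ?b = "series 0 0 (out W2 d)" and ?c = "series 0 1 (out W3 d)"
  {
    assume ext: "is_extension (m + 2) (d_star m) d"
    note low = extension_series(1)[OF ext] and lead = extension_series(2)[OF ext]
    have A: "series 0 0 (out W1 (d_star m)) = (fps_X ^ (m + 2) :: 'k fps)"
      and C: "series 0 1 (out W3 (d_star m)) = (0 :: 'k fps)"
      by (subst series_d_star; simp)+
    show "equivalent d (d_star m)"
    proof (rule equivalent_normal_form)
      show "codifferential d" using ext by (simp add: is_extension_def)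
      show "?a = series 0 0 (out W1 (d_star m)) * fps_shift (m + 2) ?a"
        unfolding A by (rule fps_eq_X_power_mult_shift) (simp add: low)
      show "?b = series 0 0 (out W1 (d_star m)) * fps_shift (m + 2) ?b"
        unfolding A by (rule fps_eq_X_power_mult_shift) (simp add: low)
      \<comment> \<open>The case \<open>k = m + 1\<close> has degree m + 2, so it is read off from
        \<open>d_star\<close>, which has no \<open>W3\<close> component. This gives one more power
        of x than the degree bound alone.\<close>
      have "fps_nth ?c k = 0" if "k < m + 2" for k
        using that low[of 0 1 k] lead[of 0 1 k] by (cases "k = m + 1") (auto simp: series_d_star)
      then have "?c = fps_X ^ (m + 2) * fps_shift (m + 2) ?c" by (rule fps_eq_X_power_mult_shift)
      \<comment> \<open>The witnesses are \<gamma> = 1 and f = c2 / x^(m + 2).\<close>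
      then show "series 0 1 (out W3 (d_star m)) + series 0 0 (out W1 (d_star m)) * fps_shift (m + 2) ?c
        = 1 * ?c" unfolding A C add_0 mult_1 by (rule sym)
      show "fps_nth (fps_shift (m + 2) ?a) 0 \<noteq> 0" by (simp add: lead series_d_star)
    qed (simp_all add: series_d_star codifferential_d_star)
  next
    assume ext: "is_extension (m + 2) (d_sharp m) d"
    note low = extension_series(1)[OF ext] and lead = extension_series(2)[OF ext]
    \<comment> \<open>Here c2 = x^(m + 1) e, and e(0) = 1 is the \<open>W3\<close> coefficient of
      \<open>d_sharp\<close>. The witnesses \<gamma> = 1/e and f = 0 reduce c2 to x^(m + 1).\<close>
    let ?e = "fps_shift (m + 1) ?c"
    have e0: "fps_nth ?e 0 \<noteq> 0" by (simp add: lead series_d_sharp)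
    have A: "series 0 0 (out W1 (d_sharp m)) = (fps_X ^ (m + 2) :: 'k fps)"
      and C: "series 0 1 (out W3 (d_sharp m)) = (fps_X ^ (m + 1) :: 'k fps)"
      by (subst series_d_sharp; simp)+
    show "equivalent d (d_sharp m)"
    proof (rule equivalent_normal_form)
      show "codifferential d" using ext by (simp add: is_extension_def)
      show "?a = series 0 0 (out W1 (d_sharp m)) * fps_shift (m + 2) ?a"
        unfolding A by (rule fps_eq_X_power_mult_shift) (simp add: low)
      show "?b = series 0 0 (out W1 (d_sharp m)) * fps_shift (m + 2) ?b"
        unfolding A by (rule fps_eq_X_power_mult_shift) (simp add: low)
      have "?c = fps_X ^ (m + 1) * ?e"
        by (rule fps_eq_X_power_mult_shift) (simp add: low)
      then have "inverse ?e * ?c = inverse ?e * (fps_X ^ (m + 1) * ?e)" by (rule arg_cong)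
      also have "\<dots> = fps_X ^ (m + 1) * (inverse ?e * ?e)" by (simp only: mult_ac)
      finally have "fps_X ^ (m + 1) = inverse ?e * ?c"
        unfolding inverse_mult_eq_1[OF e0] mult_1_right by (rule sym)
      then show "series 0 1 (out W3 (d_sharp m)) + series 0 0 (out W1 (d_sharp m)) * 0 = inverse ?e * ?c"
        unfolding C mult_zero_right add_0_right .
      show "fps_nth (fps_shift (m + 2) ?a) 0 \<noteq> 0" by (simp add: lead series_d_sharp)
      show "fps_nth (inverse ?e) 0 \<noteq> 0" using e0 by simp
    qed (simp_all add: series_d_sharp codifferential_d_sharp)
  }
qed

end
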